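(* Let $G$ be a simple graph on $l$ vertices, let $\mathfrak{g}$ be the Kac-Moody algebra with Dynkin diagram $G$, let $L_G$ be the bond lattice of $G$ with minimal element $\hat 0$, and let $\mu$ be the Möbius function of $L_G$. Then for all $\pi\in L_G$, $$\mu(\hat 0,\pi)=(-1)^{l-|\pi|}\,\operatorname{mult}\pi.$$
   Context: $G$ is a simple graph on $l$ vertices, not assumed connected. Let $A$ be its adjacency matrix and $B:=2I-A$, a symmetric generalized Cartan matrix. $\mathfrak{g}$ is the complex Kac-Moody Lie algebra constructed from $B$ (generated by a Cartan subalgebra $\mathfrak{h}$ from a minimal realization of $B$ and Chevalley generators $e_i,f_i$ subject to the Chevalley-Serre relations). Its root space decomposition is $\mathfrak{g}=\mathfrak{h}\oplus\bigoplus_{\alpha\in\Delta_+}(\mathfrak{g}_\alpha\oplus\mathfrak{g}_{-\alpha})$ with $\Delta_+$ the set of positive roots; $\operatorname{mult}\alpha:=\dim\mathfrak{g}_\alpha$. The set $\Pi$ of simple roots is identified with the vertex set of $G$. For $S\subset\Pi$, $\beta(S):=\sum_{\alpha\in S}\alpha$. A non-empty $S\subset\Pi$ is called connected if the subgraph of $G$ induced by $S$ is connected (equivalently $\operatorname{mult}\beta(S)>0$). The bond lattice $L_G$ is the set of all partitions $\pi=\{S_1,\dots,S_k\}$ of $\Pi$ into non-empty pairwise disjoint connected subsets, partially ordered by refinement: $\pi\ge\pi'$ iff $\pi'$ refines $\pi$. Here $|\pi|:=k$ is the number of parts, and $\hat 0$ is the partition into $l$ singletons, the unique minimal element. For $\pi=\{S_1,\dots,S_k\}\in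 L_G$, $\operatorname{mult}\pi:=\prod_{i=1}^k\operatorname{mult}\beta(S_i)$. *)

theory Defs
  imports
    Complex_Main
    "HOL-Library.Disjoint_Sets"
    "HOL-Library.Function_Algebras"
    "Graph_Theory.Digraph_Component"
begin

section \<open>Complex Lie algebras given by generators and relations\<close>

locale lie_algebra = vector_space scale
  for scale :: "complex \<Rightarrow> 'g::ab_group_add \<Rightarrow> 'g" +
  fixes bracket :: "'g \<Rightarrow> 'g \<Rightarrow> 'g"
  assumes bracket_add_left: "bracket (x + y) z = bracket x z + bracket y z"
    and bracket_add_right: "bracket x (y + z) = bracket x y + bracket x z"
    and bracket_scale_left: "bracket (scale c x) y = scale c (bracket x y)"
    and bracket_scale_right: "bracket x (scale c y) = scale c (bracket x y)"
    and bracket_self: "bracket x x = 0"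
    and jacobi: "bracket x (bracket y z) + bracket y (bracket z x) + bracket z (bracket x y) = 0"

datatype (gens: 'x) lie_term =
    Gen 'x
  | Zero
  | Plus "'x lie_term" "'x lie_term"
  | Smult complex "'x lie_term"
  | Brk "'x lie_term" "'x lie_term"

primrec lie_eval ::
  "(complex \<Rightarrow> 'g::ab_group_add \<Rightarrow> 'g) \<Rightarrow> ('g \<Rightarrow> 'g \<Rightarrow> 'g) \<Rightarrow> ('x \<Rightarrow> 'g) \<Rightarrow> 'x lie_term \<Rightarrow> 'g" where
  "lie_eval scale bracket \<gamma> (Gen x) = \<gamma> x"
| "lie_eval scale bracket \<gamma> Zero = 0"
| "lie_eval scale bracket \<gamma> (Plus s t) =
     lie_eval scale bracket \<gamma> s + lie_eval scale bracket \<gamma> t"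
| "lie_eval scale bracket \<gamma> (Smult c t) = scale c (lie_eval scale bracket \<gamma> t)"
| "lie_eval scale bracket \<gamma> (Brk s t) =
     bracket (lie_eval scale bracket \<gamma> s) (lie_eval scale bracket \<gamma> t)"

text \<open>The least congruence on terms that contains \<open>R\<close> and the axioms of complex Lie
  algebras; the quotient of the terms by it is the Lie algebra presented by \<open>R\<close>.\<close>

inductive lie_eq :: "('x lie_term \<times> 'x lie_term) set \<Rightarrow> 'x lie_term \<Rightarrow> 'x lie_term \<Rightarrow> bool"
  for R where
  rel: "(s, t) \<in> R \<Longrightarrow> lie_eq R s t"
| refl: "lie_eq R t t"
| sym: "lie_eq R s t \<Longrightarrow> lie_eq R t s"
| trans: "lie_eq R s t \<Longrightarrow> lie_eq R t u \<Longrightarrow> lie_eq R s u"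
| Plus_cong: "lie_eq R s s' \<Longrightarrow> lie_eq R t t' \<Longrightarrow> lie_eq R (Plus s t) (Plus s' t')"
| Smult_cong: "lie_eq R t t' \<Longrightarrow> lie_eq R (Smult c t) (Smult c t')"
| Brk_cong: "lie_eq R s s' \<Longrightarrow> lie_eq R t t' \<Longrightarrow> lie_eq R (Brk s t) (Brk s' t')"
| Plus_assoc: "lie_eq R (Plus (Plus s t) u) (Plus s (Plus t u))"
| Plus_comm: "lie_eq R (Plus s t) (Plus t s)"
| Plus_Zero: "lie_eq R (Plus t Zero) t"
| Plus_neg: "lie_eq R (Plus t (Smult (-1) t)) Zero"
| Smult_Plus: "lie_eq R (Smult c (Plus s t)) (Plus (Smult c s) (Smult c t))"
| Smult_add: "lie_eq R (Smult (c + d) t) (Plus (Smult c t) (Smult d t))"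
| Smult_Smult: "lie_eq R (Smult c (Smult d t)) (Smult (c * d) t)"
| Smult_one: "lie_eq R (Smult 1 t) t"
| Brk_Plus_left: "lie_eq R (Brk (Plus s t) u) (Plus (Brk s u) (Brk t u))"
| Brk_Plus_right: "lie_eq R (Brk s (Plus t u)) (Plus (Brk s t) (Brk s u))"
| Brk_Smult_left: "lie_eq R (Brk (Smult c s) t) (Smult c (Brk s t))"
| Brk_Smult_right: "lie_eq R (Brk s (Smult c t)) (Smult c (Brk s t))"
| Brk_self: "lie_eq R (Brk t t) Zero"
| Jacobi: "lie_eq R (Plus (Plus (Brk s (Brk t u)) (Brk t (Brk u s))) (Brk u (Brk s t))) Zero"

text \<open>\<open>\<gamma>\<close> exhibits a Lie algebra as the one generated by \<open>X\<close> subject to \<open>R\<close>: evaluation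
  induces an isomorphism from the terms over \<open>X\<close> modulo \<^const>\<open>lie_eq\<close> onto the whole type.
  This determines the Lie algebra up to isomorphism.\<close>

definition lie_presentation ::
  "(complex \<Rightarrow> 'g::ab_group_add \<Rightarrow> 'g) \<Rightarrow> ('g \<Rightarrow> 'g \<Rightarrow> 'g) \<Rightarrow>
   'x set \<Rightarrow> ('x lie_term \<times> 'x lie_term) set \<Rightarrow> ('x \<Rightarrow> 'g) \<Rightarrow> bool" where
  "lie_presentation scale bracket X R \<gamma> \<longleftrightarrow>
     lie_eval scale bracket \<gamma> ` {t. gens t \<subseteq> X} = UNIV \<and>
     (\<forall>s t. gens s \<subseteq> X \<longrightarrow> gens t \<subseteq> X \<longrightarrow>
        (lie_eval scale bracket \<gamma> s = lie_eval scale bracket \<gamma> t \<longleftrightarrow> lie_eq R s t))"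


section \<open>Kac-Moody algebras\<close>

definition fun_scale :: "complex \<Rightarrow> ('a \<Rightarrow> complex) \<Rightarrow> 'a \<Rightarrow> complex" where
  "fun_scale c f = (\<lambda>x. c * f x)"

lemma vector_space_fun_scale: "vector_space fun_scale"
  by unfold_locales (auto simp: fun_scale_def fun_eq_iff algebra_simps)

text \<open>The row rank over the complex numbers of a matrix indexed by a finite set \<open>V\<close>.\<close>

definition matrix_rank :: "'v set \<Rightarrow> ('v \<Rightarrow> 'v \<Rightarrow> int) \<Rightarrow> nat" where
  "matrix_rank V B =
     vector_space.dim fun_scale ((\<lambda>i j. if j \<in> V then complex_of_int (B i j) else 0) ` V)"

text \<open>Here the type \<open>'h\<close> is the Cartan subalgebra, \<open>\<alpha> i\<close> are the simple roots (elements of the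
  dual space) and \<open>\<alpha>v i\<close> the simple coroots, with \<open>\<langle>\<alpha>v i, \<alpha> j\<rangle> = B i j\<close>. Finite
  dimensionality is required separately because \<^const>\<open>vector_space.dim\<close> is \<open>0\<close> on
  infinite-dimensional spaces.\<close>

locale minimal_realization = vector_space hscale
  for hscale :: "complex \<Rightarrow> 'h::ab_group_add \<Rightarrow> 'h" +
  fixes V :: "'v set" and B :: "'v \<Rightarrow> 'v \<Rightarrow> int"
    and \<alpha> :: "'v \<Rightarrow> 'h \<Rightarrow> complex" and \<alpha>v :: "'v \<Rightarrow> 'h"
  assumes finite_V: "finite V"
    and finite_dimensional: "\<exists>S. finite S \<and> span S = UNIV"
    and roots_linear: "i \<in> V \<Longrightarrow> Vector_Spaces.linear hscale (*) (\<alpha> i)"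
    and roots_inj: "inj_on \<alpha> V"
    and roots_independent: "\<not> module.dependent fun_scale (\<alpha> ` V)"
    and coroots_inj: "inj_on \<alpha>v V"
    and coroots_independent: "independent (\<alpha>v ` V)"
    and pairing: "i \<in> V \<Longrightarrow> j \<in> V \<Longrightarrow> \<alpha> j (\<alpha>v i) = of_int (B i j)"
    and minimal: "dim (UNIV :: 'h set) + matrix_rank V B = 2 * card V"

datatype ('v, 'h) km_gen = E 'v | F 'v | H 'h

definition km_gens :: "'v set \<Rightarrow> ('v, 'h) km_gen set" where
  "km_gens V = E ` V \<union> F ` V \<union> range H"

abbreviation ad_power :: "nat \<Rightarrow> 'x lie_term \<Rightarrow> 'x lie_term \<Rightarrow> 'x lie_term" where
  "ad_power n s t \<equiv> (Brk s ^^ n) t"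

text \<open>The first two rules make \<open>H\<close> linear, so that the vector space \<open>'h\<close> itself, rather than
  the free vector space on it, is mapped to the Lie algebra.\<close>

inductive_set chevalley_serre ::
  "(complex \<Rightarrow> 'h::ab_group_add \<Rightarrow> 'h) \<Rightarrow> 'v set \<Rightarrow> ('v \<Rightarrow> 'v \<Rightarrow> int) \<Rightarrow>
   ('v \<Rightarrow> 'h \<Rightarrow> complex) \<Rightarrow> ('v \<Rightarrow> 'h) \<Rightarrow>
   (('v, 'h) km_gen lie_term \<times> ('v, 'h) km_gen lie_term) set"
  for hscale V B \<alpha> \<alpha>v where
  H_add: "(Gen (H (h + k)), Plus (Gen (H h)) (Gen (H k))) \<in> chevalley_serre hscale V B \<alpha> \<alpha>v"
| H_scale: "(Gen (H (hscale c h)), Smult c (Gen (H h))) \<in> chevalley_serre hscale V B \<alpha> \<alpha>v"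
| H_H: "(Brk (Gen (H h)) (Gen (H k)), Zero) \<in> chevalley_serre hscale V B \<alpha> \<alpha>v"
| H_E: "i \<in> V \<Longrightarrow> (Brk (Gen (H h)) (Gen (E i)), Smult (\<alpha> i h) (Gen (E i)))
    \<in> chevalley_serre hscale V B \<alpha> \<alpha>v"
| H_F: "i \<in> V \<Longrightarrow> (Brk (Gen (H h)) (Gen (F i)), Smult (- \<alpha> i h) (Gen (F i)))
    \<in> chevalley_serre hscale V B \<alpha> \<alpha>v"
| E_F_eq: "i \<in> V \<Longrightarrow> (Brk (Gen (E i)) (Gen (F i)), Gen (H (\<alpha>v i)))
    \<in> chevalley_serre hscale V B \<alpha> \<alpha>v"
| E_F_neq: "i \<in> V \<Longrightarrow> j \<in> V \<Longrightarrow> i \<noteq> j \<Longrightarrow> (Brk (Gen (E i)) (Gen (F j)), Zero)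
    \<in> chevalley_serre hscale V B \<alpha> \<alpha>v"
| Serre_E: "i \<in> V \<Longrightarrow> j \<in> V \<Longrightarrow> i \<noteq> j \<Longrightarrow>
    (ad_power (nat (1 - B i j)) (Gen (E i)) (Gen (E j)), Zero)
    \<in> chevalley_serre hscale V B \<alpha> \<alpha>v"
| Serre_F: "i \<in> V \<Longrightarrow> j \<in> V \<Longrightarrow> i \<noteq> j \<Longrightarrow>
    (ad_power (nat (1 - B i j)) (Gen (F i)) (Gen (F j)), Zero)
    \<in> chevalley_serre hscale V B \<alpha> \<alpha>v"

locale kac_moody_algebra =
  minimal_realization hscale V B \<alpha> \<alpha>v + g: lie_algebra scale bracket
  for hscale :: "complex \<Rightarrow> 'h::ab_group_add \<Rightarrow> 'h"
    and V :: "'v set" and B :: "'v \<Rightarrow> 'v \<Rightarrow> int"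
    and \<alpha> :: "'v \<Rightarrow> 'h \<Rightarrow> complex" and \<alpha>v :: "'v \<Rightarrow> 'h"
    and scale :: "complex \<Rightarrow> 'g::ab_group_add \<Rightarrow> 'g"
    and bracket :: "'g \<Rightarrow> 'g \<Rightarrow> 'g" +
  fixes \<gamma> :: "('v, 'h) km_gen \<Rightarrow> 'g"
  assumes presentation:
    "lie_presentation scale bracket (km_gens V) (chevalley_serre hscale V B \<alpha> \<alpha>v) \<gamma>"

definition root_space ::
  "(complex \<Rightarrow> 'g \<Rightarrow> 'g) \<Rightarrow> ('g \<Rightarrow> 'g \<Rightarrow> 'g) \<Rightarrow> (('v, 'h) km_gen \<Rightarrow> 'g) \<Rightarrow>
   ('h \<Rightarrow> complex) \<Rightarrow> 'g set" where
  "root_space scale bracket \<gamma> \<beta> = {x. \<forall>h. bracket (\<gamma> (H h)) x = scale (\<beta> h) x}"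

definition root_mult ::
  "(complex \<Rightarrow> 'g::ab_group_add \<Rightarrow> 'g) \<Rightarrow> ('g \<Rightarrow> 'g \<Rightarrow> 'g) \<Rightarrow> (('v, 'h) km_gen \<Rightarrow> 'g) \<Rightarrow>
   ('h \<Rightarrow> complex) \<Rightarrow> nat" where
  "root_mult scale bracket \<gamma> \<beta> = vector_space.dim scale (root_space scale bracket \<gamma> \<beta>)"

definition root_sum :: "('v \<Rightarrow> 'h \<Rightarrow> complex) \<Rightarrow> 'v set \<Rightarrow> 'h \<Rightarrow> complex" where
  "root_sum \<alpha> S = (\<lambda>h. \<Sum>i\<in>S. \<alpha> i h)"

definition partition_mult ::
  "(complex \<Rightarrow> 'g::ab_group_add \<Rightarrow> 'g) \<Rightarrow> ('g \<Rightarrow> 'g \<Rightarrow> 'g) \<Rightarrow> (('v, 'h) km_gen \<Rightarrow> 'g) \<Rightarrow>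
   ('v \<Rightarrow> 'h \<Rightarrow> complex) \<Rightarrow> 'v set set \<Rightarrow> nat" where
  "partition_mult scale bracket \<gamma> \<alpha> \<pi> = (\<Prod>S\<in>\<pi>. root_mult scale bracket \<gamma> (root_sum \<alpha> S))"


section \<open>The generalized Cartan matrix and the bond lattice of a graph\<close>

definition adjacency :: "'v pair_pre_digraph \<Rightarrow> 'v \<Rightarrow> 'v \<Rightarrow> int" where
  "adjacency G i j = of_bool ((i, j) \<in> parcs G)"

definition graph_cartan_matrix :: "'v pair_pre_digraph \<Rightarrow> 'v \<Rightarrow> 'v \<Rightarrow> int" where
  "graph_cartan_matrix G i j = 2 * of_bool (i = j) - adjacency G i j"

definition bond_partitions :: "'v pair_pre_digraph \<Rightarrow> 'v set set set" where
  "bond_partitions G =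
     {\<pi>. partition_on (pverts G) \<pi> \<and>
         (\<forall>S\<in>\<pi>. Digraph_Component.connected (with_proj G \<restriction> S))}"

text \<open>Pairs \<open>(\<pi>', \<pi>)\<close> with \<open>\<pi>' \<le> \<pi>\<close>, that is, \<open>\<pi>'\<close> refines \<open>\<pi>\<close>.\<close>

definition bond_order :: "'v pair_pre_digraph \<Rightarrow> ('v set set \<times> 'v set set) set" where
  "bond_order G =
     {(\<pi>', \<pi>). \<pi>' \<in> bond_partitions G \<and> \<pi> \<in> bond_partitions G \<and> refines (pverts G) \<pi>' \<pi>}"

definition bond_bottom :: "'v pair_pre_digraph \<Rightarrow> 'v set set" where
  "bond_bottom G = (\<lambda>v. {v}) ` pverts G"


section \<open>The Moebius function of a finite poset\<close>

text \<open>The order is given as the set \<open>r\<close> of pairs \<open>(x, y)\<close> with \<open>x \<le> y\<close>. The value \<open>0\<close> for an \<open>r\<close>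
  that is not a finite partial order only serves to make the recursion terminate.\<close>

function mobius :: "('a \<times> 'a) set \<Rightarrow> 'a \<Rightarrow> 'a \<Rightarrow> int" where
  "mobius r x y =
     (if finite r \<and> partial_order_on (Field r) r \<and> (x, y) \<in> r then
        if x = y then 1
        else - (\<Sum>z\<in>{z. (x, z) \<in> r \<and> (z, y) \<in> r \<and> z \<noteq> y}. mobius r x z)
      else 0)"
  by pat_completeness auto
termination
proof (relation "measure (\<lambda>(r, x, y). card {w. (w, y) \<in> r})", goal_cases)
  case (2 r x y z)
  then have fin: "finite r" and refl: "refl_on (Field r) r" and antisym: "antisym r"
    and trans: "trans r" and zy: "(z, y) \<in> r" "z \<noteq> y"
    by (auto simp: partial_order_on_def preorder_on_def)
  have "finite {w. (w, y) \<in> r}"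
    by (rule finite_subset[OF _ finite_imageI[OF fin, of fst]]) force
  moreover have "{w. (w, z) \<in> r} \<subset> {w. (w, y) \<in> r}"
  proof
    show "{w. (w, z) \<in> r} \<subseteq> {w. (w, y) \<in> r}"
      using zy trans by (auto dest: transD)
    have "(y, y) \<in> r"
      using refl zy by (auto simp: refl_on_def Field_def)
    moreover have "(y, z) \<notin> r"
      using zy antisym by (auto dest: antisymD)
    ultimately show "{w. (w, z) \<in> r} \<noteq> {w. (w, y) \<in> r}"
      by auto
  qed
  ultimately show ?case
    by (simp add: psubset_card_mono)
qed simp

declare mobius.simps [simp del]

end

theory Submission
  imports Defs
begin

text \<open>For \<open>r \<in> S\<close> the root space of \<open>\<beta>(S)\<close> is spanned by the nested brackets of the \<open>e\<^sub>i\<close>, \<open>i \<in> S\<close>,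
  taken along words that end with \<open>r\<close>. Since \<open>e\<^sub>i\<close> and \<open>e\<^sub>j\<close> commute for non-adjacent \<open>i, j\<close>, such a
  bracket depends only on the acyclic orientation of the induced graph defined by the word, and it
  vanishes unless \<open>r\<close> is the only sink. The remaining brackets are linearly independent: they are
  separated by functionals that come from the dual of a Verma module, realised on functions on
  words. So \<open>mult \<beta>(S)\<close> is the number \<open>m(S)\<close> of acyclic orientations of the induced graph with
  unique sink \<open>r\<close>. Inclusion-exclusion over the sources gives a recursion for \<open>m\<close> which says that
  the sum over all set partitions of \<open>S\<close> of the products of the \<open>- m(B)\<close> vanishes as soon as \<open>S\<close>
  contains an edge. For the graph obtained by deleting the edges between different blocks of \<open>\<pi>\<close>
  this is the defining recursion of the Moebius function at \<open>\<pi>\<close>.\<close>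

section \<open>Acyclic orientations with a unique sink\<close>

text \<open>The relations bound a multiplicity from above: they make brackets vanish or coincide.
  They give no bound from below, since elements differ only if their terms are not congruent, and
  this has to be witnessed by a module in which every relation holds, those of the f_i included.
  Passing to the dual of the Verma module avoids quotients: the Serre ideal of the free algebra
  becomes a linear condition on functions on words. The indicator of an orientation meets this
  condition because it vanishes on words with a repeated letter, which is what makes sums of
  distinct simple roots accessible.

  That the number of orientations is the same for every sink \<open>r\<close> gets no combinatorial
  proof: the multiplicity does not mention \<open>r\<close>, and the argument for the root space
  works with any \<open>r\<close> in \<open>S\<close>. The recursion over set partitions relies on
  this, since it picks a new sink in what remains after a block is removed.\<close>

primrec rooted_word :: "('v \<Rightarrow> 'v \<Rightarrow> bool) \<Rightarrow> 'v list \<Rightarrow> bool" where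
  "rooted_word adj [] \<longleftrightarrow> False"
| "rooted_word adj (a # w) \<longleftrightarrow>
     w = [] \<or> a \<notin> set w \<and> (\<exists>b\<in>set w. adj a b) \<and> rooted_word adj w"

text \<open>Edges point from the earlier to the later letter; in a word without repetition the last
  letter is thus a sink and the first a source.\<close>

primrec orient :: "('v \<Rightarrow> 'v \<Rightarrow> bool) \<Rightarrow> 'v list \<Rightarrow> ('v \<times> 'v) set" where
  "orient adj [] = {}"
| "orient adj (a # w) = {(a, b) | b. b \<in> set w \<and> adj a b} \<union> orient adj w"

definition rooted_words :: "('v \<Rightarrow> 'v \<Rightarrow> bool) \<Rightarrow> 'v \<Rightarrow> 'v set \<Rightarrow> 'v list set" where
  "rooted_words adj r T = {w. rooted_word adj w \<and> set w = T \<and> last w = r}"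

text \<open>These are the acyclic orientations of the graph induced on \<open>T\<close> whose only sink is \<open>r\<close>: each
  rooted word is a linear extension of one of them.\<close>

definition orientations :: "('v \<Rightarrow> 'v \<Rightarrow> bool) \<Rightarrow> 'v \<Rightarrow> 'v set \<Rightarrow> ('v \<times> 'v) set set" where
  "orientations adj r T = orient adj ` rooted_words adj r T"

definition independent_set :: "('v \<Rightarrow> 'v \<Rightarrow> bool) \<Rightarrow> 'v set \<Rightarrow> bool" where
  "independent_set adj J \<longleftrightarrow> (\<forall>x\<in>J. \<forall>y\<in>J. \<not> adj x y)"

text \<open>The Cartier-Foata Moebius function of the monoid in which non-adjacent letters
  commute.\<close>

definition signed_independent :: "('v \<Rightarrow> 'v \<Rightarrow> bool) \<Rightarrow> 'v set \<Rightarrow> int" where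
  "signed_independent adj J = (if independent_set adj J then (-1) ^ card J else 0)"

lemma rooted_word_distinct: "rooted_word adj w \<Longrightarrow> distinct w"
  by (induction w) auto

lemma rooted_word_later_neighbour:
  "rooted_word adj w \<Longrightarrow> x \<in> set w \<Longrightarrow> x \<noteq> last w \<Longrightarrow> \<exists>y. (x, y) \<in> orient adj w"
  by (induction w) (auto split: if_splits)

text \<open>Expresses the recursion through arcs, whose behaviour under deletion of letters is given
  by \<open>orient_filter\<close>.\<close>

lemma rooted_word_iff:
  "rooted_word adj w \<longleftrightarrow>
     w \<noteq> [] \<and> distinct w \<and> (\<forall>x\<in>set w. x \<noteq> last w \<longrightarrow> (\<exists>y. (x, y) \<in> orient adj w))"
proof (induction w)
  case (Cons a w)
  have "orient adj w \<subseteq> set w \<times> set w" for w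
    by (induction w) auto
  then show ?case
    using Cons by (cases "w = []") (auto; blast)+
qed simp

lemma orient_subset: "(x, y) \<in> orient adj w \<Longrightarrow> x \<in> set w \<and> y \<in> set w \<and> adj x y"
  by (induction w) auto

lemma orient_filter: "orient adj (filter P w) = {(x, y) \<in> orient adj w. P x \<and> P y}"
  by (induction w) auto

lemma orient_append:
  "orient adj (u @ w) = orient adj u \<union> {(x, y). x \<in> set u \<and> y \<in> set w \<and> adj x y} \<union> orient adj w"
  by (induction u) auto

lemma orient_cong:
  "(\<And>x y. x \<in> set w \<Longrightarrow> y \<in> set w \<Longrightarrow> adj x y \<longleftrightarrow> adj' x y) \<Longrightarrow> orient adj w = orient adj' w"
  by (induction w) auto

lemma rooted_word_cong:
  "(\<And>x y. x \<in> set w \<Longrightarrow> y \<in> set w \<Longrightarrow> adj x y \<longleftrightarrow> adj' x y) \<Longrightarrow> rooted_word adj w \<longleftrightarrow> rooted_word adj' w"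
  by (induction w) auto

lemma orientations_cong:
  assumes "\<And>x y. x \<in> T \<Longrightarrow> y \<in> T \<Longrightarrow> adj x y \<longleftrightarrow> adj' x y"
  shows "orientations adj r T = orientations adj' r T"
proof -
  have "rooted_words adj r T = rooted_words adj' r T"
    using assms rooted_word_cong[of _ adj adj'] by (auto simp: rooted_words_def)
  then show ?thesis
    unfolding orientations_def
    by (intro image_cong) (auto simp: rooted_words_def assms intro!: orient_cong)
qed

text \<open>No arc enters a source, so an arc leaving a vertex outside \<open>J\<close> keeps its
  head when \<open>J\<close> is deleted.\<close>

lemma rooted_word_filter:
  assumes "rooted_word adj w" and "J \<subseteq> set w - {last w}" and "\<forall>x\<in>J. \<forall>y. (y, x) \<notin> orient adj w"
  shows "rooted_word adj (filter (\<lambda>x. x \<notin> J) w)" "last (filter (\<lambda>x. x \<notin> J) w) = last w"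
proof -
  have ne: "w \<noteq> []" using assms(1) by auto
  then have eq: "w = butlast w @ [last w]" by simp
  have last_J: "last w \<notin> J" using assms(2) by auto
  have "filter (\<lambda>x. x \<notin> J) w = filter (\<lambda>x. x \<notin> J) (butlast w) @ [last w]"
    using last_J by (subst eq) simp
  then show l: "last (filter (\<lambda>x. x \<notin> J) w) = last w"
    by simp
  show "rooted_word adj (filter (\<lambda>x. x \<notin> J) w)"
    unfolding rooted_word_iff l orient_filter
  proof (intro conjI ballI impI)
    show "filter (\<lambda>x. x \<notin> J) w \<noteq> []"
      using ne last_J by (metis filter_empty_conv last_in_set)
    show "distinct (filter (\<lambda>x. x \<notin> J) w)"
      using assms(1) by (simp add: rooted_word_distinct)
    fix x assume "x \<in> set (filter (\<lambda>x. x \<notin> J) w)" "x \<noteq> last w"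
    then show "\<exists>y. (x, y) \<in> {(x, y) \<in> orient adj w. x \<notin> J \<and> y \<notin> J}"
      using rooted_word_later_neighbour[OF assms(1), of x] assms(3) by auto
  qed
qed

lemma rooted_word_append:
  assumes "rooted_word adj w" "distinct u" "set u \<inter> set w = {}" "\<forall>x\<in>set u. \<exists>y\<in>set w. adj x y"
  shows "rooted_word adj (u @ w)"
  using assms by (induction u) auto

lemma rooted_words_singleton: "rooted_words adj r {r} = {[r]}"
proof (intro set_eqI iffI)
  fix w assume w: "w \<in> rooted_words adj r {r}"
  then obtain a w' where aw: "w = a # w'" by (cases w) (auto simp: rooted_words_def)
  with w show "w \<in> {[r]}" by (cases w') (auto simp: rooted_words_def)
qed (auto simp: rooted_words_def)

lemma finite_rooted_words: "finite T \<Longrightarrow> finite (rooted_words adj r T)"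
  by (rule finite_subset[OF _ finite_subset_distinct[of T]])
     (auto simp: rooted_words_def rooted_word_distinct)

lemma finite_orientations: "finite T \<Longrightarrow> finite (orientations adj r T)"
  by (simp add: orientations_def finite_rooted_words)

lemma sum_Pow_minus_one: "finite A \<Longrightarrow> A \<noteq> {} \<Longrightarrow> (\<Sum>J\<in>Pow A. (-1) ^ card J) = (0::int)"
proof (induction A rule: finite_induct)
  case (insert a A)
  have "inj_on (insert a) (Pow A)" "Pow A \<inter> insert a ` Pow A = {}"
    using insert.hyps by (auto simp: inj_on_def)
  then have "(\<Sum>J\<in>Pow (insert a A). (-1) ^ card J) =
      (\<Sum>J\<in>Pow A. (-1) ^ card J) + (\<Sum>J\<in>Pow A. (-1) ^ card (insert a J) :: int)"
    using insert.hyps by (simp add: Pow_insert sum.union_disjoint sum.reindex)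
  also have "(\<Sum>J\<in>Pow A. (-1) ^ card (insert a J) :: int) = (\<Sum>J\<in>Pow A. - ((-1) ^ card J))"
    using insert.hyps
    by (intro sum.cong HOL.refl) (subst card_insert_disjoint; auto intro: finite_subset)
  finally show ?case
    by (simp add: sum_negf)
qed simp

section \<open>Counting orientations by their sources\<close>

locale simple_adjacency =
  fixes adj :: "'v \<Rightarrow> 'v \<Rightarrow> bool"
  assumes adj_sym: "adj x y \<Longrightarrow> adj y x" and adj_irrefl: "\<not> adj x x"
begin

lemma orient_total:
  assumes "x \<in> set w" "y \<in> set w" "adj x y"
  shows "(x, y) \<in> orient adj w \<or> (y, x) \<in> orient adj w"
proof -
  have "x \<noteq> y" using assms(3) adj_irrefl by auto
  then show ?thesis
    using assms adj_sym[OF assms(3)] by (induction w) auto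
qed

lemma orient_independent: "independent_set adj (set w) \<Longrightarrow> orient adj w = {}"
  using orient_subset[of _ _ adj w] by (fastforce simp: independent_set_def)

text \<open>All edges at a set \<open>J\<close> of sources point away from it, so the orientation is
  determined on \<open>T - J\<close>. An edge inside \<open>J\<close> would enter one of its ends,
  and a member of \<open>J\<close> without a neighbour in \<open>T - J\<close> would be a second
  sink.\<close>

lemma card_orientations_sources:
  assumes T: "finite T" and J: "J \<subseteq> T - {r}"
  shows "card {ori \<in> orientations adj r T. \<forall>x\<in>J. \<forall>y. (y, x) \<notin> ori} =
    (if independent_set adj J \<and> (\<forall>x\<in>J. \<exists>y\<in>T - J. adj x y) then card (orientations adj r (T - J))
     else 0)"
proof (cases "independent_set adj J \<and> (\<forall>x\<in>J. \<exists>y\<in>T - J. adj x y)")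
  case True
  let ?g = "\<lambda>ori. ori \<union> {(x, y). x \<in> J \<and> y \<in> T - J \<and> adj x y}"
  let ?A = "{ori \<in> orientations adj r T. \<forall>x\<in>J. \<forall>y. (y, x) \<notin> ori}"
  have inj: "inj_on ?g (orientations adj r (T - J))"
  proof (rule inj_onI)
    fix p q assume pq: "p \<in> orientations adj r (T - J)" "q \<in> orientations adj r (T - J)" "?g p = ?g q"
    \<comment> \<open>The added arcs are exactly those that start in \<open>J\<close>.\<close>
    have "p = {(x, y) \<in> ?g p. x \<notin> J}" "q = {(x, y) \<in> ?g q. x \<notin> J}"
      using pq(1,2) orient_subset[of _ _ adj] by (fastforce simp: orientations_def rooted_words_def)+
    then show "p = q" using pq(3) by metis
  qed
  have "?g ` orientations adj r (T - J) = ?A"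
  proof (intro set_eqI iffI)
    fix p assume "p \<in> ?g ` orientations adj r (T - J)"
    then obtain w where w: "rooted_word adj w" "set w = T - J" "last w = r" "p = ?g (orient adj w)"
      by (auto simp: orientations_def rooted_words_def)
    obtain js where js: "set js = J" "distinct js"
      using finite_distinct_list[of J] J T by (meson finite_Diff finite_subset)
    have rw: "rooted_word adj (js @ w)"
      using w js True by (intro rooted_word_append) auto
    have or: "orient adj (js @ w) = p"
      using w js True by (auto simp: orient_append orient_independent)
    have "p \<in> orientations adj r T"
      unfolding orientations_def rooted_words_def using rw or[symmetric] w js J
      by (cases "w = []") (auto intro!: imageI)
    then show "p \<in> ?A"
      using w(2,4) orient_subset[of _ _ adj w] by fastforce
  next
    fix p assume "p \<in> ?A"
    then obtain w where w: "rooted_word adj w" "set w = T" "last w = r" "p = orient adj w"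
      and src: "\<forall>x\<in>J. \<forall>y. (y, x) \<notin> orient adj w"
      by (auto simp: orientations_def rooted_words_def)
    let ?w = "filter (\<lambda>x. x \<notin> J) w"
    have rw: "rooted_word adj ?w" "last ?w = r"
      using rooted_word_filter[OF w(1), of J] src w J by auto
    have "p = ?g (orient adj ?w)"
      unfolding w(4) orient_filter
    proof (intro subset_antisym subrelI)
      fix x y assume xy: "(x, y) \<in> orient adj w"
      then show "(x, y) \<in> ?g {(x, y) \<in> orient adj w. x \<notin> J \<and> y \<notin> J}"
        using src w(2) orient_subset[OF xy] by auto
    next
      fix x y assume "(x, y) \<in> ?g {(x, y) \<in> orient adj w. x \<notin> J \<and> y \<notin> J}"
      then show "(x, y) \<in> orient adj w"
        using src w(2) orient_total[of x w y] J by auto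
    qed
    moreover have "orient adj ?w \<in> orientations adj r (T - J)"
      unfolding orientations_def rooted_words_def using rw w by auto
    ultimately show "p \<in> ?g ` orientations adj r (T - J)"
      by blast
  qed
  with inj have "card ?A = card (orientations adj r (T - J))"
    using card_image by fastforce
  then show ?thesis using True by simp
next
  case False
  have "{ori \<in> orientations adj r T. \<forall>x\<in>J. \<forall>y. (y, x) \<notin> ori} = {}"
  proof (rule ccontr)
    assume "\<not> ?thesis"
    then obtain w where w: "rooted_word adj w" "set w = T" "last w = r"
      and src: "\<forall>x\<in>J. \<forall>y. (y, x) \<notin> orient adj w"
      by (auto simp: orientations_def rooted_words_def)
    have ind: "independent_set adj J"
      unfolding independent_set_def using src w(2) orient_total[of _ w] J by blast
    have "\<exists>y\<in>T - J. adj x y" if x: "x \<in> J" for x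
    proof -
      obtain y where y: "(x, y) \<in> orient adj w"
        using rooted_word_later_neighbour[OF w(1), of x] x J w by auto
      then show ?thesis
        using orient_subset[OF y] src w(2) by auto
    qed
    then show False using False ind by blast
  qed
  then show ?thesis using False by (simp only: card.empty if_False)
qed

text \<open>Inclusion-exclusion over the sources of an orientation: one whose only sink is \<open>r\<close>
  always has a source other than \<open>r\<close>.\<close>

lemma sum_orientations_sources:
  assumes T: "finite T" "r \<in> T" "T \<noteq> {r}"
  shows "(\<Sum>J\<in>Pow (T - {r}). if independent_set adj J \<and> (\<forall>x\<in>J. \<exists>y\<in>T - J. adj x y)
            then (-1) ^ card J * int (card (orientations adj r (T - J))) else 0) = 0"
proof -
  let ?O = "orientations adj r T"
  let ?src = "\<lambda>ori. {x \<in> T - {r}. \<forall>y. (y, x) \<notin> ori}"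
  have src_ne: "?src ori \<noteq> {}" if ori: "ori \<in> ?O" for ori
  proof -
    obtain w where w: "rooted_word adj w" "set w = T" "last w = r" "ori = orient adj w"
      using ori by (auto simp: orientations_def rooted_words_def)
    \<comment> \<open>The first letter of a linear extension is a source; it differs from the last
      letter \<open>r\<close> because \<open>T\<close> has a second element.\<close>
    then obtain a w' where aw: "w = a # w'" by (cases w) auto
    have "w' \<noteq> []" using w aw T by auto
    moreover have d: "distinct w" using w(1) by (rule rooted_word_distinct)
    ultimately have "a \<noteq> r" using w(3) aw by auto
    moreover have "\<forall>y. (y, a) \<notin> ori"
      using d unfolding w(4) aw by (auto dest: orient_subset)
    ultimately show ?thesis using w aw by auto
  qed
  have "0 = (\<Sum>ori\<in>?O. \<Sum>J\<in>Pow (?src ori). (-1) ^ card J :: int)"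
    using sum_Pow_minus_one[OF _ src_ne] T by simp
  also have "\<dots> = (\<Sum>ori\<in>?O. \<Sum>J\<in>Pow (T - {r}). if \<forall>x\<in>J. \<forall>y. (y, x) \<notin> ori then (-1) ^ card J else 0)"
    using T(1) by (intro sum.cong HOL.refl sum.mono_neutral_cong_left) auto
  also have "\<dots> = (\<Sum>J\<in>Pow (T - {r}). \<Sum>ori\<in>?O. if \<forall>x\<in>J. \<forall>y. (y, x) \<notin> ori then (-1) ^ card J else 0)"
    by (rule sum.swap)
  also have "\<dots> = (\<Sum>J\<in>Pow (T - {r}). (-1) ^ card J * int (card {ori \<in> ?O. \<forall>x\<in>J. \<forall>y. (y, x) \<notin> ori}))"
    using T(1) by (intro sum.cong HOL.refl)
      (simp add: finite_orientations sum.If_cases Int_def flip: sum.inter_filter)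
  also have "\<dots> = (\<Sum>J\<in>Pow (T - {r}). if independent_set adj J \<and> (\<forall>x\<in>J. \<exists>y\<in>T - J. adj x y)
            then (-1) ^ card J * int (card (orientations adj r (T - J))) else 0)"
    using T(1) by (intro sum.cong HOL.refl) (subst card_orientations_sources; auto)
  finally show ?thesis by simp
qed

lemma orientations_isolated:
  assumes "x \<in> T" "x \<noteq> r" "\<forall>y\<in>T. \<not> adj x y"
  shows "orientations adj r T = {}"
proof -
  have False if "w \<in> rooted_words adj r T" for w
    using that assms rooted_word_later_neighbour[of adj w x] orient_subset[of x _ adj w]
    by (auto simp: rooted_words_def)
  then show ?thesis by (auto simp: orientations_def)
qed

text \<open>If \<open>S\<close> has an edge at every vertex other than \<open>r\<close>, the sum is
  the one from inclusion-exclusion, and both sides vanish unless \<open>S\<close> is a single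
  vertex. An isolated vertex other than \<open>r\<close> can be split off, which changes the sign of
  both sides.\<close>

lemma sum_orientations_signed_independent:
  assumes "finite S" "r \<in> S"
  shows "(\<Sum>J\<in>Pow (S - {r}). int (card (orientations adj r (S - J))) * signed_independent adj J) =
    - signed_independent adj S"
  using assms
proof (induction "card S" arbitrary: S rule: less_induct)
  case less
  let ?i = "signed_independent adj" and ?N = "\<lambda>T. int (card (orientations adj r T))"
  show ?case
  proof (cases "\<exists>x\<in>S - {r}. \<forall>y\<in>S. \<not> adj x y")
    case True
    then obtain x where x: "x \<in> S" "x \<noteq> r" "\<forall>y\<in>S. \<not> adj x y" by auto
    have i_insert: "?i (insert x J) = - ?i J" if "J \<subseteq> S - {x}" for J
    proof -
      have "finite J" "x \<notin> J" using that less.prems by (auto intro: finite_subset)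
      moreover have "independent_set adj (insert x J) \<longleftrightarrow> independent_set adj J"
        using that x adj_sym adj_irrefl unfolding independent_set_def by blast
      ultimately show ?thesis by (simp add: signed_independent_def)
    qed
    let ?S = "S - {x}"
    have "S - {r} = insert x (?S - {r})"
      using x by auto
    then have P: "Pow (S - {r}) = Pow (?S - {r}) \<union> insert x ` Pow (?S - {r})"
      by (simp only: Pow_insert)
    have inj: "inj_on (insert x) (Pow (?S - {r}))" "Pow (?S - {r}) \<inter> insert x ` Pow (?S - {r}) = {}"
      by (auto simp: inj_on_def)
    have "(\<Sum>J\<in>Pow (S - {r}). ?N (S - J) * ?i J) =
        (\<Sum>J\<in>Pow (?S - {r}). ?N (S - J) * ?i J) + (\<Sum>J\<in>Pow (?S - {r}). ?N (S - insert x J) * ?i (insert x J))"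
      unfolding P using inj less.prems by (subst sum.union_disjoint) (auto simp: sum.reindex)
    \<comment> \<open>Here \<open>x\<close> remains in \<open>S - J\<close>, where it would be a
      sink besides \<open>r\<close>.\<close>
    also have "(\<Sum>J\<in>Pow (?S - {r}). ?N (S - J) * ?i J) = 0"
      using x by (intro sum.neutral ballI) (subst orientations_isolated[of x]; auto)
    also have "(\<Sum>J\<in>Pow (?S - {r}). ?N (S - insert x J) * ?i (insert x J)) =
        - (\<Sum>J\<in>Pow (?S - {r}). ?N (?S - J) * ?i J)"
      unfolding sum_negf[symmetric]
    proof (intro sum.cong HOL.refl)
      fix J assume "J \<in> Pow (?S - {r})"
      then have "?i (insert x J) = - ?i J"
        by (intro i_insert) auto
      moreover have "S - insert x J = ?S - J"
        by auto
      ultimately show "?N (S - insert x J) * ?i (insert x J) = - (?N (?S - J) * ?i J)"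
        by simp
    qed
    also have "(\<Sum>J\<in>Pow (?S - {r}). ?N (?S - J) * ?i J) = - ?i ?S"
    proof (rule less.hyps)
      show "card ?S < card S"
        using less.prems x by (intro psubset_card_mono) auto
    qed (use less.prems x in auto)
    also have "?i ?S = - ?i S"
      using i_insert[of ?S] x by (simp add: insert_absorb)
    finally show ?thesis by simp
  next
    case no_isolated: False
    show ?thesis
    proof (cases "S = {r}")
      case True
      then show ?thesis
        using adj_irrefl
        by (simp add: rooted_words_singleton orientations_def signed_independent_def independent_set_def)
    next
      case False
      then obtain x where "x \<in> S - {r}" using less.prems by auto
      then have "?i S = 0"
        using no_isolated unfolding signed_independent_def independent_set_def by (meson DiffD1)
      \<comment> \<open>A neighbour of a member of an independent set lies outside that set, so the
        side condition of \<open>sum_orientations_sources\<close> holds automatically.\<close>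
      moreover have "(\<Sum>J\<in>Pow (S - {r}). ?N (S - J) * ?i J) =
          (\<Sum>J\<in>Pow (S - {r}). if independent_set adj J \<and> (\<forall>x\<in>J. \<exists>y\<in>S - J. adj x y)
            then (-1) ^ card J * ?N (S - J) else 0)"
      proof (intro sum.cong HOL.refl)
        fix J assume J: "J \<in> Pow (S - {r})"
        then have "\<forall>x\<in>J. \<exists>y\<in>S - J. adj x y" if "independent_set adj J"
          using no_isolated that unfolding independent_set_def by blast
        then show "?N (S - J) * ?i J = (if independent_set adj J \<and> (\<forall>x\<in>J. \<exists>y\<in>S - J. adj x y)
            then (-1) ^ card J * ?N (S - J) else 0)"
          by (auto simp: signed_independent_def)
      qed
      ultimately show ?thesis
        using sum_orientations_sources[OF less.prems False] by simp
    qed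
  qed
qed

end

section \<open>Set partitions and the exponential of a set function\<close>

lemma sum_partition_on_block:
  fixes f :: "'a set \<Rightarrow> 'b::comm_ring_1"
  assumes S: "finite S" "r \<in> S"
  shows "(\<Sum>\<pi> | partition_on S \<pi>. \<Prod>B\<in>\<pi>. f B) =
    (\<Sum>J\<in>Pow (S - {r}). f (S - J) * (\<Sum>\<pi> | partition_on J \<pi>. \<Prod>B\<in>\<pi>. f B))"
proof -
  \<comment> \<open>\<open>J\<close> is the union of the blocks that avoid \<open>r\<close>, so
    \<open>S - J\<close> is the block of \<open>r\<close>; testing blocks for \<open>r\<close>
    recovers \<open>J\<close> and the rest of the partition.\<close>
  let ?D = "SIGMA J:Pow (S - {r}). {\<pi>. partition_on J \<pi>}"
  let ?g = "\<lambda>(J, \<pi>). insert (S - J) \<pi>"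
  have fin: "finite J" if "J \<subseteq> S - {r}" for J
    using that S by (auto intro: finite_subset)
  have r_block: "r \<in> S - J" if "J \<in> Pow (S - {r})" for J
    using that S by auto
  have r_other: "r \<notin> B" if "J \<in> Pow (S - {r})" "partition_on J \<pi>" "B \<in> \<pi>" for J \<pi> B
    using that by (auto simp: partition_on_def)
  have inj: "inj_on ?g ?D"
  proof (rule inj_onI, clarify)
    fix J \<pi> J' \<pi>'
    assume J: "J \<subseteq> S - {r}" "J' \<subseteq> S - {r}" and p: "partition_on J \<pi>" "partition_on J' \<pi>'"
      and eq: "insert (S - J) \<pi> = insert (S - J') \<pi>'"
    have a: "{B \<in> insert (S - J) \<pi>. r \<in> B} = {S - J}" "{B \<in> insert (S - J') \<pi>'. r \<in> B} = {S - J'}"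
      using r_block r_other J p by blast+
    then have SJ: "S - J = S - J'" using eq by auto
    have "{B \<in> insert (S - J) \<pi>. r \<notin> B} = \<pi>" "{B \<in> insert (S - J') \<pi>'. r \<notin> B} = \<pi>'"
      using r_block r_other J p by blast+
    then have "\<pi> = \<pi>'" using eq by auto
    then show "J = J' \<and> \<pi> = \<pi>'" using SJ J by blast
  qed
  have img: "?g ` ?D = {\<pi>. partition_on S \<pi>}"
  proof (intro set_eqI iffI)
    fix \<pi> assume "\<pi> \<in> ?g ` ?D"
    then obtain J \<rho> where J: "J \<subseteq> S - {r}" "partition_on J \<rho>" "\<pi> = insert (S - J) \<rho>" by auto
    have "S - (S - J) = J" using J by auto
    moreover have "disjnt (S - J) (\<Union>\<rho>)"
      using J(2) by (auto simp: partition_on_def disjnt_def)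
    ultimately show "\<pi> \<in> {\<pi>. partition_on S \<pi>}"
      using J S(2) partition_on_insert[of "S - J" \<rho> S] by auto
  next
    fix \<pi> assume "\<pi> \<in> {\<pi>. partition_on S \<pi>}"
    then have p: "partition_on S \<pi>" by simp
    obtain B where B: "B \<in> \<pi>" "r \<in> B" using S p by (auto simp: partition_on_def)
    have BS: "B \<subseteq> S" using p B by (auto simp: partition_on_def)
    have "disjnt B (\<Union>(\<pi> - {B}))"
      using p B by (auto simp: partition_on_def disjnt_def disjoint_def)
    then have "partition_on (S - B) (\<pi> - {B})"
      using p partition_on_insert[of B "\<pi> - {B}" S] B by (simp add: insert_absorb)
    moreover have "insert (S - (S - B)) (\<pi> - {B}) = \<pi>"
      using B BS by (auto simp: double_diff)
    ultimately show "\<pi> \<in> ?g ` ?D"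
      using B by (intro image_eqI[of _ _ "(S - B, \<pi> - {B})"]) auto
  qed
  have "(\<Sum>\<pi> | partition_on S \<pi>. \<Prod>B\<in>\<pi>. f B) = (\<Sum>(J, \<pi>)\<in>?D. \<Prod>B\<in>insert (S - J) \<pi>. f B)"
    unfolding img[symmetric] using inj by (subst sum.reindex) (auto simp: case_prod_unfold)
  also have "\<dots> = (\<Sum>(J, \<pi>)\<in>?D. f (S - J) * (\<Prod>B\<in>\<pi>. f B))"
  proof (intro sum.cong HOL.refl, clarify)
    fix J \<pi> assume J: "J \<subseteq> S - {r}" "partition_on J \<pi>"
    have "finite \<pi>" using finite_elements[OF fin[OF J(1)] J(2)] .
    moreover have "S - J \<notin> \<pi>" using J r_other r_block by blast
    ultimately show "(\<Prod>B\<in>insert (S - J) \<pi>. f B) = f (S - J) * (\<Prod>B\<in>\<pi>. f B)" by simp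
  qed
  also have "\<dots> = (\<Sum>J\<in>Pow (S - {r}). \<Sum>\<pi> | partition_on J \<pi>. f (S - J) * (\<Prod>B\<in>\<pi>. f B))"
    using S fin by (subst sum.Sigma) (auto intro: finitely_many_partition_on)
  finally show ?thesis
    by (simp add: sum_distrib_left)
qed

text \<open>This says that \<^const>\<open>signed_independent\<close> is the exponential of \<open>- f\<close> with respect to
  the convolution of set functions over disjoint unions.\<close>

lemma (in simple_adjacency) sum_partition_on_orientations:
  fixes f :: "'v set \<Rightarrow> int"
  assumes "finite S" "\<And>r T. r \<in> T \<Longrightarrow> T \<subseteq> S \<Longrightarrow> f T = int (card (orientations adj r T))"
  shows "(\<Sum>\<pi> | partition_on S \<pi>. \<Prod>B\<in>\<pi>. - f B) = signed_independent adj S"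
  using assms
proof (induction "card S" arbitrary: S rule: less_induct)
  case less
  show ?case
  proof (cases "S = {}")
    case True
    have "{\<pi>. partition_on {} \<pi>} = {{} :: 'v set set}"
      by (auto simp: partition_on_empty)
    then show ?thesis using True by (simp add: signed_independent_def independent_set_def)
  next
    case False
    \<comment> \<open>Any root will do, and the induction hypothesis for \<open>J\<close> uses
      another one, as \<open>r\<close> is not in \<open>J\<close>; hence the assumption on
      \<open>f\<close> for all roots at once.\<close>
    then obtain r where r: "r \<in> S" by auto
    have "(\<Sum>\<pi> | partition_on S \<pi>. \<Prod>B\<in>\<pi>. - f B) =
        (\<Sum>J\<in>Pow (S - {r}). - f (S - J) * signed_independent adj J)"
      unfolding sum_partition_on_block[OF less.prems(1) r]
    proof (intro sum.cong HOL.refl)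
      fix J assume J: "J \<in> Pow (S - {r})"
      have "(\<Sum>\<pi> | partition_on J \<pi>. \<Prod>B\<in>\<pi>. - f B) = signed_independent adj J"
      proof (rule less.hyps)
        show "card J < card S"
          using J r less.prems(1) by (intro psubset_card_mono) auto
        show "finite J"
          using J less.prems(1) by (auto intro: finite_subset)
        show "f T = int (card (orientations adj q T))" if "q \<in> T" "T \<subseteq> J" for q T
          using that J by (intro less.prems(2)) auto
      qed
      then show "- f (S - J) * (\<Sum>\<pi> | partition_on J \<pi>. \<Prod>B\<in>\<pi>. - f B) =
          - f (S - J) * signed_independent adj J" by simp
    qed
    also have "\<dots> = - (\<Sum>J\<in>Pow (S - {r}). int (card (orientations adj r (S - J))) * signed_independent adj J)"
      unfolding sum_negf[symmetric] 
    proof (intro sum.cong HOL.refl)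
      fix J assume "J \<in> Pow (S - {r})"
      then have "f (S - J) = int (card (orientations adj r (S - J)))"
        using r by (intro less.prems(2)) auto
      then show "- f (S - J) * signed_independent adj J =
          - (int (card (orientations adj r (S - J))) * signed_independent adj J)"
        by simp
    qed
    also have "\<dots> = signed_independent adj S"
      using sum_orientations_signed_independent[OF less.prems(1) r] by simp
    finally show ?thesis .
  qed
qed

section \<open>Root spaces of Kac-Moody algebras\<close>

primrec word_weight :: "('v \<Rightarrow> 'h \<Rightarrow> complex) \<Rightarrow> 'v list \<Rightarrow> 'h \<Rightarrow> complex" where
  "word_weight \<alpha> [] h = 0"
| "word_weight \<alpha> (i # w) h = \<alpha> i h + word_weight \<alpha> w h"

fun word_term :: "('v \<Rightarrow> 'x) \<Rightarrow> 'v list \<Rightarrow> 'x lie_term" where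
  "word_term c [] = Zero"
| "word_term c [i] = Gen (c i)"
| "word_term c (i # j # w) = Brk (Gen (c i)) (word_term c (j # w))"

section \<open>Nested brackets in a Lie algebra\<close>

context lie_algebra
begin

lemma bracket_zero_left [simp]: "bracket 0 y = 0"
  using bracket_scale_left[of 0 0 y] by simp

lemma bracket_zero_right [simp]: "bracket x 0 = 0"
  using bracket_scale_right[of x 0 0] by simp

lemma bracket_anticommute: "bracket x y = - bracket y x"
proof -
  have "bracket (x + y) (x + y) = bracket x y + bracket y x"
    unfolding bracket_add_left bracket_add_right by (simp add: bracket_self)
  then show ?thesis
    by (simp add: bracket_self eq_neg_iff_add_eq_0)
qed

lemma bracket_minus_right: "bracket x (- y) = - bracket x y"
  using bracket_add_right[of x y "- y"] by (simp add: eq_neg_iff_add_eq_0 add.commute)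

lemma bracket_derivation:
  "bracket x (bracket y z) = bracket (bracket x y) z + bracket y (bracket x z)"
proof -
  have "bracket y (bracket z x) = - bracket y (bracket x z)"
    by (subst bracket_anticommute[of z x]) (rule bracket_minus_right)
  moreover have "bracket z (bracket x y) = - bracket (bracket x y) z"
    by (rule bracket_anticommute)
  ultimately show ?thesis
    using jacobi[of x y z] by (simp add: algebra_simps)
qed

lemma bracket_span:
  assumes "y \<in> span S" and "\<And>s. s \<in> S \<Longrightarrow> bracket x s \<in> span T"
  shows "bracket x y \<in> span T"
  using assms(1)
proof (induction rule: span_induct_alt)
  case base
  then show ?case by (simp add: span_zero)
next
  case (step c s y)
  then show ?case
    by (simp add: bracket_add_right bracket_scale_right span_add span_scale assms(2))
qed

fun nested :: "('v \<Rightarrow> 'g) \<Rightarrow> 'v list \<Rightarrow> 'g" where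
  "nested x [] = 0"
| "nested x [i] = x i"
| "nested x (i # j # w) = bracket (x i) (nested x (j # w))"

lemma nested_Cons: "w \<noteq> [] \<Longrightarrow> nested x (i # w) = bracket (x i) (nested x w)"
  by (cases w) simp_all

lemma lie_eval_word_term: "lie_eval scale bracket \<gamma> (word_term c w) = nested (\<lambda>i. \<gamma> (c i)) w"
  by (induction c w rule: word_term.induct) simp_all

lemma nested_commute:
  "(\<And>b. b \<in> set w \<Longrightarrow> bracket y (x b) = 0) \<Longrightarrow> bracket y (nested x w) = 0"
  by (induction x w rule: nested.induct) (simp_all add: bracket_derivation[of y])

text \<open>By the Jacobi identity, commuting elements have commuting adjoint operators; those of
  \<open>p\<close> and \<open>a\<close> act here on the bracket of \<open>s\<close>.\<close>

lemma nested_move_front: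
  assumes "s \<noteq> []" and "\<And>b. b \<in> set p \<Longrightarrow> bracket (x a) (x b) = 0"
  shows "nested x (p @ a # s) = nested x (a # p @ s)"
  using assms(2)
proof (induction p)
  case (Cons b p)
  then have "nested x (b # p @ a # s) = bracket (x b) (bracket (x a) (nested x (p @ s)))"
    using assms(1) by (simp add: nested_Cons)
  also have "\<dots> = bracket (x a) (bracket (x b) (nested x (p @ s)))"
    using Cons.prems[of b] bracket_anticommute[of "x b" "x a"]
    by (simp add: bracket_derivation[of "x b"])
  finally show ?case
    using assms(1) by (simp add: nested_Cons)
qed simp

text \<open>By [[x_i, U], v] = [x_i, [U, v]] - [U, [x_i, v]] a letter of \<open>u\<close> is either
  put in front or absorbed into the right factor. Thus \<open>v\<close> stays a suffix, and its last
  letter stays last.\<close>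

lemma bracket_nested_nested:
  assumes "u \<noteq> []" "v \<noteq> []"
  shows "bracket (nested x u) (nested x v) \<in> span {nested x (u' @ v) | u'. mset u' = mset u}"
  using assms
proof (induction x u arbitrary: v rule: nested.induct)
  case (2 x i)
  then have "bracket (nested x [i]) (nested x v) = nested x ([i] @ v)"
    by (simp add: nested_Cons)
  then show ?case
    by (auto intro!: span_base)
next
  case (3 x i j w)
  let ?u = "j # w"
  let ?T = "{nested x (u' @ v) | u'. mset u' = mset (i # ?u)}"
  have "bracket (x i) (bracket (nested x ?u) (nested x v)) \<in> span ?T"
  proof (rule bracket_span[OF "3.IH"[OF _ \<open>v \<noteq> []\<close>]])
    fix s assume "s \<in> {nested x (u' @ v) |u'. mset u' = mset (j # w)}"
    then obtain u' where u': "s = nested x (u' @ v)" "mset u' = mset (j # w)" by auto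
    then have "bracket (x i) s = nested x ((i # u') @ v)" "mset (i # u') = mset (i # ?u)"
      using \<open>v \<noteq> []\<close> by (simp_all add: nested_Cons)
    then show "bracket (x i) s \<in> span ?T"
      by (intro span_base) blast
  qed simp
  moreover have "bracket (nested x ?u) (nested x (i # v)) \<in> span ?T"
  proof (rule set_mp[OF span_mono "3.IH"])
    show "{nested x (u' @ i # v) |u'. mset u' = mset ?u} \<subseteq> ?T"
    proof clarify
      fix u' assume "mset u' = mset ?u"
      then have "nested x (u' @ i # v) = nested x ((u' @ [i]) @ v)" "mset (u' @ [i]) = mset (i # ?u)"
        by simp_all
      then show "\<exists>u''. nested x (u' @ i # v) = nested x (u'' @ v) \<and> mset u'' = mset (i # ?u)"
        by blast
    qed
  qed simp_all
  moreover have "bracket (nested x (i # ?u)) (nested x v) =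
      bracket (x i) (bracket (nested x ?u) (nested x v)) - bracket (nested x ?u) (nested x (i # v))"
    using \<open>v \<noteq> []\<close> bracket_derivation[of "x i" "nested x ?u" "nested x v"]
    by (simp add: nested_Cons)
  ultimately show ?case
    by (simp add: span_diff)
qed simp

text \<open>If \<open>r\<close> is the first letter, antisymmetry makes \<open>[r]\<close> the right
  factor, and \<open>bracket_nested_nested\<close> keeps it at the end.\<close>

lemma nested_span_last:
  assumes "r \<in> set w"
  shows "nested x w \<in> span {nested x w' | w'. mset w' = mset w \<and> last w' = r}"
  using assms
proof (induction w)
  case (Cons i w)
  let ?T = "{nested x w' | w'. mset w' = mset (i # w) \<and> last w' = r}"
  consider "w = []" | "w \<noteq> []" "r \<in> set w" | "w \<noteq> []" "r = i"
    using Cons.prems by auto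
  then show ?case
  proof cases
    case 1
    then have "nested x (i # w) \<in> ?T" using Cons.prems by auto
    then show ?thesis by (rule span_base)
  next
    case 2
    have "bracket (x i) (nested x w) \<in> span ?T"
    proof (rule bracket_span[OF Cons.IH[OF 2(2)]])
      fix s assume "s \<in> {nested x w' | w'. mset w' = mset w \<and> last w' = r}"
      then obtain w' where w': "s = nested x w'" "mset w' = mset w" "last w' = r" by auto
      have ne: "w' \<noteq> []" using w'(2) 2(1) by auto
      have "bracket (x i) s = nested x (i # w')" "mset (i # w') = mset (i # w)" "last (i # w') = r"
        using w' ne by (simp_all add: nested_Cons)
      then show "bracket (x i) s \<in> span ?T"
        by (intro span_base) blast
    qed
    then show ?thesis using 2 by (simp add: nested_Cons)
  next
    case 3
    have "bracket (nested x w) (nested x [r]) \<in> span ?T"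
    proof (rule set_mp[OF span_mono bracket_nested_nested])
      show "{nested x (u' @ [r]) |u'. mset u' = mset w} \<subseteq> ?T"
      proof clarify
        fix u' assume "mset u' = mset w"
        then have "mset (u' @ [r]) = mset (i # w)" "last (u' @ [r]) = r" using 3 by simp_all
        then show "\<exists>w'. nested x (u' @ [r]) = nested x w' \<and> mset w' = mset (i # w) \<and> last w' = r"
          by blast
      qed
    qed (use 3 in simp_all)
    then have "- bracket (nested x w) (x r) \<in> span ?T"
      by (simp add: span_neg)
    then show ?thesis
      using 3 bracket_anticommute[of "x r" "nested x w"] by (simp add: nested_Cons)
  qed
qed simp

lemma nested_weight:
  assumes "\<And>i. i \<in> set w \<Longrightarrow> bracket z (x i) = scale (a i h) (x i)"
  shows "bracket z (nested x w) = scale (word_weight a w h) (nested x w)"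
  using assms
proof (induction x w rule: nested.induct)
  case (3 x i j w)
  then show ?case
    by (simp add: bracket_derivation[of z] bracket_scale_left bracket_scale_right bracket_add_right
        scale_left_distrib)
qed simp_all

text \<open>Half of the triangular decomposition, used once with \<open>y\<close> an f_j against
  words in the e_i and once with the roles exchanged; \<open>a\<close> carries the sign of the
  weights. The derivation rule moves \<open>y\<close> inwards until it meets its partner and leaves
  a Cartan element.\<close>

lemma opposite_nested:
  assumes weight: "\<And>h i. i \<in> V \<Longrightarrow> bracket (\<eta> h) (x i) = scale (a i h) (x i)"
    and opposite: "\<And>i. i \<in> V \<Longrightarrow> bracket y (x i) \<in> span (range \<eta>)"
    and w: "w \<noteq> []" "set w \<subseteq> V"
  shows "bracket y (nested x w) \<in> span (range \<eta> \<union> {nested x w | w. w \<noteq> [] \<and> set w \<subseteq> V})"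
  using w
proof (induction w)
  case (Cons i w)
  let ?N = "range \<eta> \<union> {nested x w | w. w \<noteq> [] \<and> set w \<subseteq> V}"
  have i: "i \<in> V" using Cons.prems by simp
  have base: "bracket y (x i) \<in> span ?N"
    using span_mono[of "range \<eta>" ?N] opposite[OF i] by auto
  have N: "nested x w \<in> span ?N" if "w \<noteq> []" "set w \<subseteq> V" for w
    using that by (intro span_base) blast
  show ?case
  proof (cases "w = []")
    case True
    then show ?thesis using base by simp
  next
    case False
    \<comment> \<open>The inner bracket lies in the Cartan part, which acts on a nested bracket by
      scalars.\<close>
    have "bracket (nested x w) (bracket y (x i)) \<in> span ?N"
    proof (rule bracket_span[OF opposite[OF i]])
      fix s assume "s \<in> range \<eta>"
      then obtain h where "s = \<eta> h" by auto
      moreover have "bracket (\<eta> h) (nested x w) = scale (word_weight a w h) (nested x w)"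
        using Cons.prems weight by (intro nested_weight) auto
      ultimately show "bracket (nested x w) s \<in> span ?N"
        using bracket_anticommute[of "nested x w" s] N[of w] False Cons.prems
        by (simp add: span_neg span_scale)
    qed
    then have "bracket (bracket y (x i)) (nested x w) \<in> span ?N"
      using bracket_anticommute[of "bracket y (x i)" "nested x w"] by (simp add: span_neg)
    moreover have "bracket (x i) (bracket y (nested x w)) \<in> span ?N"
    proof (rule bracket_span[OF Cons.IH])
      fix s assume "s \<in> ?N"
      then consider h where "s = \<eta> h" | u where "s = nested x u" "u \<noteq> []" "set u \<subseteq> V" by auto
      then show "bracket (x i) s \<in> span ?N"
      proof cases
        case 1
        then show ?thesis
          using bracket_anticommute[of "x i" s] weight[OF i, of h] N[of "[i]"] i
          by (simp add: span_neg span_scale)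
      next
        case 2
        then show ?thesis
          using N[of "i # u"] i by (simp add: nested_Cons)
      qed
    qed (use False Cons.prems in auto)
    ultimately show ?thesis
      using False by (simp add: nested_Cons bracket_derivation[of y] span_add)
  qed
qed simp

end

section \<open>Weight vectors of the Kac-Moody algebra\<close>

context kac_moody_algebra
begin

text \<open>\<open>lie_presentation\<close> compares only terms over the generating set, so the
  relations must be seen to stay inside it.\<close>

lemma gens_chevalley_serre:
  assumes "(s, t) \<in> chevalley_serre hscale V B \<alpha> \<alpha>v"
  shows "gens s \<subseteq> km_gens V" "gens t \<subseteq> km_gens V"
proof -
  have pow: "gens ((Brk (Gen a) ^^ n) (Gen b)) \<subseteq> {a, b}" for a b :: "('v, 'h) km_gen" and n
    by (induction n) auto
  from assms show "gens s \<subseteq> km_gens V" "gens t \<subseteq> km_gens V"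
    by (cases; use pow in \<open>fastforce simp: km_gens_def\<close>)+
qed

lemma relation_holds:
  assumes "(s, t) \<in> chevalley_serre hscale V B \<alpha> \<alpha>v"
  shows "lie_eval scale bracket \<gamma> s = lie_eval scale bracket \<gamma> t"
  using presentation gens_chevalley_serre[OF assms] lie_eq.rel[OF assms]
  unfolding lie_presentation_def by blast

lemmas bracket_H_H = relation_holds[OF H_H, simplified]
  and bracket_H_E = relation_holds[OF H_E, simplified]
  and bracket_E_F_eq = relation_holds[OF E_F_eq, simplified]
  and bracket_E_F_neq = relation_holds[OF E_F_neq, simplified]

lemma bracket_H_F: "i \<in> V \<Longrightarrow> bracket (\<gamma> (H h)) (\<gamma> (F i)) = scale (- \<alpha> i h) (\<gamma> (F i))"
  using relation_holds[OF H_F] by simp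

abbreviation e_word :: "'v list \<Rightarrow> 'g" where
  "e_word \<equiv> g.nested (\<lambda>i. \<gamma> (E i))"

abbreviation f_word :: "'v list \<Rightarrow> 'g" where
  "f_word \<equiv> g.nested (\<lambda>i. \<gamma> (F i))"

abbreviation weight_space :: "('h \<Rightarrow> complex) \<Rightarrow> 'g set" where
  "weight_space \<equiv> root_space scale bracket \<gamma>"

lemma e_word_weight: "set w \<subseteq> V \<Longrightarrow> e_word w \<in> weight_space (word_weight \<alpha> w)"
  unfolding root_space_def by (auto intro!: g.nested_weight bracket_H_E)

lemma f_word_weight: "set w \<subseteq> V \<Longrightarrow> f_word w \<in> weight_space (word_weight (\<lambda>i h. - \<alpha> i h) w)"
  unfolding root_space_def by (auto intro!: g.nested_weight[where a = "\<lambda>i h. - \<alpha> i h"] bracket_H_F)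

text \<open>The candidates spanning the Cartan, the positive and the negative part; each of them is
  a weight vector.\<close>

definition weight_vectors :: "'g set" where
  "weight_vectors = range (\<lambda>h. \<gamma> (H h)) \<union> {e_word w | w. w \<noteq> [] \<and> set w \<subseteq> V}
     \<union> {f_word w | w. w \<noteq> [] \<and> set w \<subseteq> V}"

lemma weight_vectors_H: "\<gamma> (H h) \<in> g.span weight_vectors"
  by (rule g.span_base) (simp add: weight_vectors_def)

lemma weight_vectors_E: "w \<noteq> [] \<Longrightarrow> set w \<subseteq> V \<Longrightarrow> e_word w \<in> g.span weight_vectors"
  by (rule g.span_base) (auto simp: weight_vectors_def)

lemma weight_vectors_F: "w \<noteq> [] \<Longrightarrow> set w \<subseteq> V \<Longrightarrow> f_word w \<in> g.span weight_vectors"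
  by (rule g.span_base) (auto simp: weight_vectors_def)

lemma bracket_gen_weight_vectors:
  assumes x: "x \<in> km_gens V" and s: "s \<in> weight_vectors"
  shows "bracket (\<gamma> x) s \<in> g.span weight_vectors"
proof -
  from s consider (H) h where "s = \<gamma> (H h)" | (E) w where "s = e_word w" "w \<noteq> []" "set w \<subseteq> V"
    | (F) w where "s = f_word w" "w \<noteq> []" "set w \<subseteq> V"
    unfolding weight_vectors_def by auto
  note s_cases = this
  have span_HE: "g.span (range (\<lambda>h. \<gamma> (H h)) \<union> {e_word w | w. w \<noteq> [] \<and> set w \<subseteq> V}) \<subseteq> g.span weight_vectors"
    and span_HF: "g.span (range (\<lambda>h. \<gamma> (H h)) \<union> {f_word w | w. w \<noteq> [] \<and> set w \<subseteq> V}) \<subseteq> g.span weight_vectors"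
    by (rule g.span_mono; auto simp: weight_vectors_def)+
  have H: "\<gamma> (H h) \<in> g.span (range (\<lambda>h. \<gamma> (H h)))" for h
    by (rule g.span_base) simp
  from x consider k where "x = H k" | i where "x = E i" "i \<in> V" | i where "x = F i" "i \<in> V"
    unfolding km_gens_def by auto
  then show ?thesis
  proof cases
    case 1
    from s_cases show ?thesis
    proof cases
      case H
      then show ?thesis using 1 by (simp add: bracket_H_H g.span_zero)
    next
      case E
      then show ?thesis
        using 1 e_word_weight[of w] weight_vectors_E[of w] by (simp add: root_space_def g.span_scale)
    next
      case F
      then show ?thesis
        using 1 f_word_weight[of w] weight_vectors_F[of w] by (simp add: root_space_def g.span_scale)
    qed
  next
    case (2 i)
    from s_cases show ?thesis
    proof cases
      case H
      then show ?thesis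
        using 2 g.bracket_anticommute[of "\<gamma> (E i)" s] weight_vectors_E[of "[i]"]
        by (simp add: bracket_H_E g.span_neg g.span_scale)
    next
      case E
      then show ?thesis
        using 2 weight_vectors_E[of "i # w"] by (simp add: g.nested_Cons)
    next
      case F
      have "bracket (\<gamma> (E i)) (f_word w) \<in>
          g.span (range (\<lambda>h. \<gamma> (H h)) \<union> {f_word w | w. w \<noteq> [] \<and> set w \<subseteq> V})"
      proof (rule g.opposite_nested[where a = "\<lambda>i h. - \<alpha> i h", OF bracket_H_F])
        fix j assume "j \<in> V"
        then show "bracket (\<gamma> (E i)) (\<gamma> (F j)) \<in> g.span (range (\<lambda>h. \<gamma> (H h)))"
          using 2 by (cases "i = j") (simp_all add: bracket_E_F_eq bracket_E_F_neq g.span_zero H)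
      qed (use F in auto)
      then show ?thesis using 2 F span_HF by auto
    qed
  next
    case (3 i)
    from s_cases show ?thesis
    proof cases
      case H
      then show ?thesis
        using 3 g.bracket_anticommute[of "\<gamma> (F i)" s] weight_vectors_F[of "[i]"]
        by (simp add: bracket_H_F g.span_neg g.span_scale)
    next
      case F
      then show ?thesis
        using 3 weight_vectors_F[of "i # w"] by (simp add: g.nested_Cons)
    next
      case E
      have "bracket (\<gamma> (F i)) (e_word w) \<in>
          g.span (range (\<lambda>h. \<gamma> (H h)) \<union> {e_word w | w. w \<noteq> [] \<and> set w \<subseteq> V})"
      proof (rule g.opposite_nested[where a = \<alpha>, OF bracket_H_E])
        fix j assume "j \<in> V"
        then show "bracket (\<gamma> (F i)) (\<gamma> (E j)) \<in> g.span (range (\<lambda>h. \<gamma> (H h)))"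
          using 3 g.bracket_anticommute[of "\<gamma> (F i)" "\<gamma> (E j)"]
          by (cases "i = j") (simp_all add: bracket_E_F_eq bracket_E_F_neq g.span_zero g.span_neg H)
      qed (use E in auto)
      then show ?thesis using 3 E span_HE by auto
    qed
  qed
qed

text \<open>For a bracket of terms, membership in the span needs stability of the span under the
  adjoint action of values; this second claim is carried through the induction and passes to
  brackets by the Jacobi identity.\<close>

lemma span_weight_vectors: "g.span weight_vectors = UNIV"
proof -
  let ?ev = "lie_eval scale bracket \<gamma>" and ?M = "g.span weight_vectors"
  have "?ev t \<in> ?M \<and> (\<forall>m\<in>?M. bracket (?ev t) m \<in> ?M)" if "gens t \<subseteq> km_gens V" for t
    using that
  proof (induction t)
    case (Gen x)
    then have x: "x \<in> km_gens V" by simp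
    then have "\<gamma> x \<in> ?M"
      using weight_vectors_H weight_vectors_E[of "[_]"] weight_vectors_F[of "[_]"]
      by (auto simp: km_gens_def)
    moreover have "bracket (\<gamma> x) m \<in> ?M" if "m \<in> ?M" for m
      using that bracket_gen_weight_vectors[OF x] by (rule g.bracket_span)
    ultimately show ?case by simp
  next
    case (Brk s t)
    have "bracket (bracket (?ev s) (?ev t)) m \<in> ?M" if "m \<in> ?M" for m
    proof -
      have "bracket (bracket (?ev s) (?ev t)) m =
          bracket (?ev s) (bracket (?ev t) m) - bracket (?ev t) (bracket (?ev s) m)"
        using g.bracket_derivation[of "?ev s" "?ev t" m] by simp
      then show ?thesis using Brk that by (simp add: g.span_diff)
    qed
    then show ?case using Brk by simp
  qed (simp_all add: g.span_zero g.span_add g.span_scale g.bracket_add_left g.bracket_scale_left)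
  then have "?ev ` {t. gens t \<subseteq> km_gens V} \<subseteq> ?M"
    by blast
  moreover have "?ev ` {t. gens t \<subseteq> km_gens V} = UNIV"
    using presentation by (simp add: lie_presentation_def)
  ultimately show ?thesis
    by auto
qed

lemma subspace_weight_space: "g.subspace (weight_space \<beta>)"
  by (rule g.subspaceI)
    (simp_all add: root_space_def g.bracket_add_right g.bracket_scale_right g.scale_right_distrib
      g.scale_left_commute)

text \<open>The usual argument for eigenvectors: for an \<open>h\<close> separating \<beta> from
  \<beta>0, the operator ad h - \<beta>0(h) kills the component at \<beta>0 and multiplies the one
  at \<beta> by a non-zero number.\<close>

lemma weight_spaces_independent:
  assumes "finite \<Omega>" "\<And>\<beta>. \<beta> \<in> \<Omega> \<Longrightarrow> y \<beta> \<in> weight_space \<beta>" "sum y \<Omega> = 0" "\<beta> \<in> \<Omega>"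
  shows "y \<beta> = 0"
  using assms
proof (induction \<Omega> arbitrary: y \<beta> rule: finite_induct)
  case (insert \<beta>0 \<Omega>)
  have zero: "y \<beta> = 0" if \<beta>: "\<beta> \<in> \<Omega>" for \<beta>
  proof -
    have "\<beta> \<noteq> \<beta>0" using \<beta> insert.hyps by auto
    then obtain h where h: "\<beta> h \<noteq> \<beta>0 h" by (auto simp: fun_eq_iff)
    let ?z = "\<lambda>\<beta>. scale (\<beta> h - \<beta>0 h) (y \<beta>)"
    have y0: "y \<beta>0 = - sum y \<Omega>"
      using insert.hyps insert.prems(2) by (simp add: eq_neg_iff_add_eq_0)
    have "bracket (\<gamma> (H h)) (sum y A) = (\<Sum>\<beta>\<in>A. scale (\<beta> h) (y \<beta>))" if "A \<subseteq> insert \<beta>0 \<Omega>" for A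
      using finite_subset[OF that] insert.hyps that
    proof (induction A rule: infinite_finite_induct)
      case (insert b A)
      then show ?case
        using \<open>\<And>\<beta>. \<beta> \<in> insert \<beta>0 \<Omega> \<Longrightarrow> y \<beta> \<in> weight_space \<beta>\<close>[of b]
        by (simp add: g.bracket_add_right root_space_def)
    qed simp_all
    from this[of "insert \<beta>0 \<Omega>"] have "(\<Sum>\<beta>\<in>insert \<beta>0 \<Omega>. scale (\<beta> h) (y \<beta>)) = 0"
      using insert.prems(2) by simp
    then have "sum ?z \<Omega> = 0"
      using insert.hyps y0
      by (simp add: g.scale_left_diff_distrib sum_subtractf g.scale_sum_right[symmetric])
    then have "?z \<beta> = 0"
      using insert.prems(1) \<beta>
      by (intro insert.IH[of ?z]) (auto intro!: g.subspace_scale[OF subspace_weight_space])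
    then show ?thesis using h by simp
  qed
  then have "sum y \<Omega> = 0" by (simp add: sum.neutral)
  then have "y \<beta>0 = 0" using insert by simp
  then show ?case using zero insert.prems(3) by auto
qed simp

lemma span_Int_weight_space:
  assumes x: "x \<in> g.span S" "x \<in> weight_space \<beta>"
    and S: "\<And>b. b \<in> S \<Longrightarrow> \<exists>\<omega>. b \<in> weight_space \<omega>"
  shows "x \<in> g.span (S \<inter> weight_space \<beta>)"
proof -
  obtain \<omega> where \<omega>: "\<And>b. b \<in> S \<Longrightarrow> b \<in> weight_space (\<omega> b)" using S by metis
  obtain T r where T: "finite T" "T \<subseteq> S" "x = (\<Sum>b\<in>T. scale (r b) b)"
    using x(1) unfolding g.span_explicit by blast
  \<comment> \<open>\<beta> is added in case no vector of \<open>T\<close> was assigned this weight.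
    Subtracting \<open>x\<close> from the component at \<beta> gives weight vectors with sum
    zero.\<close>
  let ?\<Omega> = "insert \<beta> (\<omega> ` T)"
  let ?c = "\<lambda>\<delta>. \<Sum>b | b \<in> T \<and> \<omega> b = \<delta>. scale (r b) b"
  let ?y = "\<lambda>\<delta>. ?c \<delta> - (if \<delta> = \<beta> then x else 0)"
  have "?y \<beta> = 0"
  proof (rule weight_spaces_independent[of ?\<Omega> ?y \<beta>])
    fix \<delta> assume "\<delta> \<in> ?\<Omega>"
    have "?c \<delta> \<in> weight_space \<delta>"
      using T(2) \<omega>
      by (intro g.subspace_sum[OF subspace_weight_space] g.subspace_scale[OF subspace_weight_space]) auto
    then show "?y \<delta> \<in> weight_space \<delta>"
      using x(2) g.subspace_diff[OF subspace_weight_space] by auto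
  next
    have "sum ?c ?\<Omega> = x"
      unfolding T(3) using T(1) by (intro sum.group) auto
    then show "sum ?y ?\<Omega> = 0"
      using T(1) by (simp add: sum_subtractf)
  qed (use T in auto)
  then have "x = ?c \<beta>" by simp
  also have "\<dots> \<in> g.span (S \<inter> weight_space \<beta>)"
    using T(2) \<omega> by (intro g.span_sum g.span_scale g.span_base) auto
  finally show ?thesis .
qed

lemma weight_unique: "x \<in> weight_space \<beta> \<Longrightarrow> x \<in> weight_space \<delta> \<Longrightarrow> x \<noteq> 0 \<Longrightarrow> \<beta> = \<delta>"
  by (auto simp: root_space_def fun_eq_iff)

text \<open>Independence is assumed for the set of simple roots; injectivity of
  \<open>\<alpha>\<close> on \<open>V\<close> lets the coefficients be indexed by vertices.\<close>

lemma root_coefficients: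
  assumes "\<And>h. (\<Sum>i\<in>V. c i * \<alpha> i h) = 0" and "i \<in> V"
  shows "c i = 0"
proof -
  interpret fs: vector_space fun_scale by (rule vector_space_fun_scale)
  let ?u = "\<lambda>\<beta>. c (the_inv_into V \<alpha> \<beta>)"
  have sum_apply: "sum f A h = (\<Sum>x\<in>A. f x h)" for f :: "'v \<Rightarrow> 'h \<Rightarrow> complex" and A h
    by (induction A rule: infinite_finite_induct) simp_all
  have "(\<Sum>\<beta>\<in>\<alpha> ` V. fun_scale (?u \<beta>) \<beta>) = (\<Sum>i\<in>V. fun_scale (c i) (\<alpha> i))"
    by (simp add: sum.reindex[OF roots_inj] the_inv_into_f_f[OF roots_inj])
  also have "\<dots> = 0"
    using assms(1) by (auto simp: fun_eq_iff sum_apply fun_scale_def)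
  finally have "?u (\<alpha> i) = 0"
    using roots_independent finite_V assms(2) by (intro fs.independentD[of "\<alpha> ` V" "\<alpha> ` V"]) auto
  then show ?thesis
    using assms(2) by (simp add: the_inv_into_f_f[OF roots_inj])
qed

lemma word_weight_count:
  "set w \<subseteq> V \<Longrightarrow> word_weight a w h = (\<Sum>i\<in>V. of_nat (count_list w i) * a i h)"
proof (induction w)
  case (Cons j w)
  have "(\<Sum>i\<in>V. of_nat (count_list (j # w) i) * a i h) =
      (\<Sum>i\<in>V. (if i = j then a i h else 0) + of_nat (count_list w i) * a i h)"
    by (intro sum.cong HOL.refl) (auto simp: algebra_simps)
  then show ?case
    using Cons finite_V by (simp add: sum.distrib)
qed simp

lemma root_sum_indicator: "S \<subseteq> V \<Longrightarrow> root_sum \<alpha> S h = (\<Sum>i\<in>V. of_bool (i \<in> S) * \<alpha> i h)"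
  unfolding root_sum_def using finite_V by (intro sum.mono_neutral_cong_left) auto

text \<open>By independence of the simple roots, the weight of a word determines how often each
  letter occurs; here the counts are 0 and 1.\<close>

lemma word_weight_eq_root_sum:
  assumes "set w \<subseteq> V" "S \<subseteq> V"
  shows "word_weight \<alpha> w = root_sum \<alpha> S \<longleftrightarrow> distinct w \<and> set w = S"
proof
  assume eq: "word_weight \<alpha> w = root_sum \<alpha> S"
  have "(of_nat (count_list w i) - of_bool (i \<in> S) :: complex) = 0" if "i \<in> V" for i
  proof (rule root_coefficients[OF _ that])
    fix h
    show "(\<Sum>i\<in>V. (of_nat (count_list w i) - of_bool (i \<in> S)) * \<alpha> i h) = 0"
      using fun_cong[OF eq, of h] assms
      by (simp add: word_weight_count root_sum_indicator left_diff_distrib sum_subtractf)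
  qed
  then have "of_nat (count_list w i) = (of_nat (of_bool (i \<in> S)) :: complex)" if "i \<in> V" for i
    using that by simp
  then have count: "count_list w i = of_bool (i \<in> S)" if "i \<in> V" for i
    using that unfolding of_nat_eq_iff by blast
  have set: "set w = S"
  proof (intro set_eqI iffI)
    fix i assume "i \<in> set w"
    then show "i \<in> S" using count[of i] assms count_list_0_iff[of w i] by (auto split: if_splits)
  next
    fix i assume "i \<in> S"
    then show "i \<in> set w" using count[of i] assms count_list_0_iff[of w i] by auto
  qed
  have "length w = (\<Sum>i\<in>S. count_list w i)"
    using sum_count_set[of w S] set finite_subset[OF assms(2) finite_V] by simp
  also have "\<dots> = (\<Sum>i\<in>S. 1)"
    using count assms(2) by (intro sum.cong) auto
  finally show "distinct w \<and> set w = S"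
    using set card_distinct[of w] by simp
next
  assume "distinct w \<and> set w = S"
  moreover have "distinct w \<Longrightarrow> word_weight \<alpha> w h = root_sum \<alpha> (set w) h" for h
    by (induction w) (simp_all add: root_sum_def)
  ultimately show "word_weight \<alpha> w = root_sum \<alpha> S" by auto
qed

lemma root_space_root_sum:
  assumes S: "S \<subseteq> V" "S \<noteq> {}"
  shows "weight_space (root_sum \<alpha> S) = g.span {e_word w | w. distinct w \<and> set w = S}"
proof
  show "g.span {e_word w | w. distinct w \<and> set w = S} \<subseteq> weight_space (root_sum \<alpha> S)"
  proof (rule g.span_minimal[OF _ subspace_weight_space], clarify)
    fix w assume "distinct w" "S = set w"
    then show "e_word w \<in> weight_space (root_sum \<alpha> (set w))"
      using e_word_weight[of w] word_weight_eq_root_sum[of w S] S by simp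
  qed
  show "weight_space (root_sum \<alpha> S) \<subseteq> g.span {e_word w | w. distinct w \<and> set w = S}"
  proof
    fix x assume x: "x \<in> weight_space (root_sum \<alpha> S)"
    obtain i where i: "i \<in> S" using S by auto
    \<comment> \<open>A coefficient would be at most 0 on the right and 1 on the left. The empty
      word covers the Cartan part, whose weight is 0.\<close>
    have neg: "root_sum \<alpha> S \<noteq> word_weight (\<lambda>i h. - \<alpha> i h) w" if "set w \<subseteq> V" for w
    proof
      assume eq: "root_sum \<alpha> S = word_weight (\<lambda>i h. - \<alpha> i h) w"
      have "(of_nat (count_list w i) + of_bool (i \<in> S) :: complex) = 0"
      proof (rule root_coefficients[of "\<lambda>i. of_nat (count_list w i) + of_bool (i \<in> S)"])
        fix h
        show "(\<Sum>i\<in>V. (of_nat (count_list w i) + of_bool (i \<in> S)) * \<alpha> i h) = 0"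
          using fun_cong[OF eq, of h] that S
          by (simp add: word_weight_count root_sum_indicator distrib_right sum.distrib sum_negf)
      qed (use i S in auto)
      then have "of_nat (count_list w i + 1) = (0 :: complex)" using i by (simp add: add.commute)
      then show False unfolding of_nat_eq_0_iff by simp
    qed
    \<comment> \<open>A spanning vector that happens to be 0 lies in every weight space, hence the
      inserted 0.\<close>
    have weights: "(\<exists>\<omega>. b \<in> weight_space \<omega>) \<and>
        (b \<in> weight_space (root_sum \<alpha> S) \<longrightarrow> b \<in> insert 0 {e_word w | w. distinct w \<and> set w = S})"
      if "b \<in> weight_vectors" for b
    proof -
      from that consider h where "b = \<gamma> (H h)" | w where "b = e_word w" "set w \<subseteq> V"
        | w where "b = f_word w" "set w \<subseteq> V"
        unfolding weight_vectors_def by auto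
      then show ?thesis
      proof cases
        case 1
        have "b \<in> weight_space (word_weight (\<lambda>i h. - \<alpha> i h) [])"
          unfolding 1 root_space_def by (simp add: bracket_H_H)
        then show ?thesis using neg[of "[]"] weight_unique[of b] by auto
      next
        case 2
        then show ?thesis
          using e_word_weight[of w] weight_unique[of b "word_weight \<alpha> w" "root_sum \<alpha> S"]
            word_weight_eq_root_sum[of w S] S by auto
      next
        case 3
        then show ?thesis
          using f_word_weight[of w] weight_unique[of b] neg[of w] by auto
      qed
    qed
    have "x \<in> g.span (weight_vectors \<inter> weight_space (root_sum \<alpha> S))"
      using x weights span_weight_vectors by (intro span_Int_weight_space) auto
    also have "\<dots> \<subseteq> g.span (insert 0 {e_word w | w. distinct w \<and> set w = S})"
      using weights by (intro g.span_mono) auto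
    finally show "x \<in> g.span {e_word w | w. distinct w \<and> set w = S}"
      by simp
  qed
qed

end

section \<open>A representation on functions on words\<close>

primrec term_act ::
  "('x \<Rightarrow> ('a \<Rightarrow> complex) \<Rightarrow> 'a \<Rightarrow> complex) \<Rightarrow> 'x lie_term \<Rightarrow> ('a \<Rightarrow> complex) \<Rightarrow> 'a \<Rightarrow> complex" where
  "term_act D (Gen x) = D x"
| "term_act D Zero = (\<lambda>\<Psi> w. 0)"
| "term_act D (Plus s t) = (\<lambda>\<Psi> w. term_act D s \<Psi> w + term_act D t \<Psi> w)"
| "term_act D (Smult c t) = (\<lambda>\<Psi> w. c * term_act D t \<Psi> w)"
| "term_act D (Brk s t) =
     (\<lambda>\<Psi> w. term_act D s (term_act D t \<Psi>) w - term_act D t (term_act D s \<Psi>) w)"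

text \<open>The relations are imposed only on the invariant subspace \<open>K\<close>, because the
  Serre relations of the e_i can fail on arbitrary functions.\<close>

locale lie_action =
  fixes D :: "'x \<Rightarrow> ('a \<Rightarrow> complex) \<Rightarrow> 'a \<Rightarrow> complex" and K :: "('a \<Rightarrow> complex) set"
    and R :: "('x lie_term \<times> 'x lie_term) set"
  assumes D_add: "D x (\<lambda>w. \<Phi> w + \<Psi> w) = (\<lambda>w. D x \<Phi> w + D x \<Psi> w)"
    and D_scale: "D x (\<lambda>w. c * \<Psi> w) = (\<lambda>w. c * D x \<Psi> w)"
    and K_add: "\<Phi> \<in> K \<Longrightarrow> \<Psi> \<in> K \<Longrightarrow> (\<lambda>w. \<Phi> w + \<Psi> w) \<in> K"
    and K_scale: "\<Psi> \<in> K \<Longrightarrow> (\<lambda>w. c * \<Psi> w) \<in> K"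
    and D_K: "\<Psi> \<in> K \<Longrightarrow> D x \<Psi> \<in> K"
    and D_rel: "(s, t) \<in> R \<Longrightarrow> \<Psi> \<in> K \<Longrightarrow> term_act D s \<Psi> = term_act D t \<Psi>"
begin

lemma K_diff: "\<Phi> \<in> K \<Longrightarrow> \<Psi> \<in> K \<Longrightarrow> (\<lambda>w. \<Phi> w - \<Psi> w) \<in> K"
  using K_add[of \<Phi> "\<lambda>w. - 1 * \<Psi> w"] K_scale[of \<Psi> "-1"] by simp

lemma term_act_scale: "term_act D t (\<lambda>w. c * \<Psi> w) = (\<lambda>w. c * term_act D t \<Psi> w)"
  by (induction t arbitrary: \<Psi>) (simp_all add: D_scale algebra_simps)

lemma term_act_add:
  "term_act D t (\<lambda>w. \<Phi> w + \<Psi> w) = (\<lambda>w. term_act D t \<Phi> w + term_act D t \<Psi> w)"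
  by (induction t arbitrary: \<Phi> \<Psi>) (simp_all add: D_add algebra_simps)

lemma term_act_diff:
  "term_act D t (\<lambda>w. \<Phi> w - \<Psi> w) = (\<lambda>w. term_act D t \<Phi> w - term_act D t \<Psi> w)"
  using term_act_add[of t \<Phi> "\<lambda>w. - 1 * \<Psi> w"] by (simp only: term_act_scale) simp

lemma term_act_zero: "term_act D t (\<lambda>w. 0) = (\<lambda>w. 0)"
  using term_act_scale[of t 0 "\<lambda>w. 0"] by simp

lemma term_act_K: "\<Psi> \<in> K \<Longrightarrow> term_act D t \<Psi> \<in> K"
proof (induction t arbitrary: \<Psi>)
  case Zero
  then show ?case using K_scale[of \<Psi> 0] by simp
qed (simp_all add: D_K K_add K_scale K_diff)

text \<open>Soundness of the congruence for commutators of operators, so terms that act differently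
  on \<open>K\<close> have different values. The invariance of \<open>K\<close> enters when a
  relation is applied after another term has acted.\<close>

lemma lie_eq_term_act: "lie_eq R s t \<Longrightarrow> \<Psi> \<in> K \<Longrightarrow> term_act D s \<Psi> = term_act D t \<Psi>"
proof (induction arbitrary: \<Psi> rule: lie_eq.induct)
  case (rel s t)
  then show ?case by (rule D_rel)
qed (simp_all add: term_act_K term_act_add term_act_diff term_act_scale term_act_zero algebra_simps)

end

section \<open>The dual Verma module and the Serre relations\<close>

lemma word_weight_append: "word_weight \<alpha> (u @ w) h = word_weight \<alpha> u h + word_weight \<alpha> w h"
  by (induction u) simp_all

text \<open>The value of \<Psi> at f_j applied to the word, computed by f_j e_i = e_i f_j -
  \<delta>_ij h_j: here h_j scales a word by its weight, and f_j kills the empty word, the lowest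
  weight vector.\<close>

primrec lower ::
  "('v \<Rightarrow> 'h \<Rightarrow> complex) \<Rightarrow> ('v \<Rightarrow> 'h) \<Rightarrow> 'v \<Rightarrow> 'v list \<Rightarrow> ('v list \<Rightarrow> complex) \<Rightarrow> complex" where
  "lower \<alpha> \<alpha>v j [] \<Psi> = 0"
| "lower \<alpha> \<alpha>v j (i # w) \<Psi> = lower \<alpha> \<alpha>v j w (\<lambda>v. \<Psi> (i # v)) -
     (if i = j then word_weight \<alpha> w (\<alpha>v j) * \<Psi> w else 0)"

text \<open>The dual of the lowest weight Verma module of weight \<open>0\<close> over the algebra without the Serre
  relations, whose underlying space is the free associative algebra on the \<open>e\<^sub>i\<close>: the operator
  of \<open>e\<^sub>i\<close> is dual to multiplication, and that of \<open>f\<^sub>j\<close> is then forced by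
  \<open>[e\<^sub>i, f\<^sub>j] = \<delta>\<^sub>i\<^sub>j \<alpha>\<^sub>i\<^sup>\<or>\<close>.\<close>

primrec word_act ::
  "('v \<Rightarrow> 'h \<Rightarrow> complex) \<Rightarrow> ('v \<Rightarrow> 'h) \<Rightarrow> ('v, 'h) km_gen \<Rightarrow> ('v list \<Rightarrow> complex) \<Rightarrow> 'v list \<Rightarrow> complex" where
  "word_act \<alpha> \<alpha>v (E i) = (\<lambda>\<Psi> w. \<Psi> (i # w))"
| "word_act \<alpha> \<alpha>v (F j) = (\<lambda>\<Psi> w. lower \<alpha> \<alpha>v j w \<Psi>)"
| "word_act \<alpha> \<alpha>v (H h) = (\<lambda>\<Psi> w. - word_weight \<alpha> w h * \<Psi> w)"

lemma lower_add: "lower \<alpha> \<alpha>v j w (\<lambda>v. \<Phi> v + \<Psi> v) = lower \<alpha> \<alpha>v j w \<Phi> + lower \<alpha> \<alpha>v j w \<Psi>"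
  by (induction w arbitrary: \<Phi> \<Psi>) (simp_all add: algebra_simps)

lemma lower_scale: "lower \<alpha> \<alpha>v j w (\<lambda>v. c * \<Psi> v) = c * lower \<alpha> \<alpha>v j w \<Psi>"
  by (induction w arbitrary: \<Psi>) (simp_all add: algebra_simps)

lemma lower_diff: "lower \<alpha> \<alpha>v j w (\<lambda>v. \<Phi> v - \<Psi> v) = lower \<alpha> \<alpha>v j w \<Phi> - lower \<alpha> \<alpha>v j w \<Psi>"
  by (induction w arbitrary: \<Phi> \<Psi>) (simp_all add: algebra_simps)

lemma lower_zero: "lower \<alpha> \<alpha>v j w (\<lambda>v. 0) = 0"
  by (induction w) simp_all

text \<open>The transposed form of [h, f_j] = - \<alpha>_j(h) f_j.\<close>

lemma lower_weight:
  "lower \<alpha> \<alpha>v j w (\<lambda>v. word_weight \<alpha> v h * \<Psi> v) = (word_weight \<alpha> w h - \<alpha> j h) * lower \<alpha> \<alpha>v j w \<Psi>"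
proof (induction w arbitrary: \<Psi>)
  case (Cons i w)
  have "lower \<alpha> \<alpha>v j w (\<lambda>v. word_weight \<alpha> (i # v) h * \<Psi> (i # v)) =
      lower \<alpha> \<alpha>v j w (\<lambda>v. \<alpha> i h * \<Psi> (i # v) + word_weight \<alpha> v h * \<Psi> (i # v))"
    by (simp add: algebra_simps)
  also have "\<dots> = (word_weight \<alpha> (i # w) h - \<alpha> j h) * lower \<alpha> \<alpha>v j w (\<lambda>v. \<Psi> (i # v))"
    by (simp add: lower_add lower_scale Cons) (simp add: algebra_simps)
  finally have eq: "lower \<alpha> \<alpha>v j w (\<lambda>v. word_weight \<alpha> (i # v) h * \<Psi> (i # v)) =
      (word_weight \<alpha> (i # w) h - \<alpha> j h) * lower \<alpha> \<alpha>v j w (\<lambda>v. \<Psi> (i # v))" .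
  show ?case
    unfolding lower.simps eq by (auto simp: algebra_simps)
qed simp

lemma lower_weight_diff:
  "lower \<alpha> \<alpha>v j w (\<lambda>v. (word_weight \<alpha> v h - c) * \<Psi> v) =
     (word_weight \<alpha> w h - \<alpha> j h - c) * lower \<alpha> \<alpha>v j w \<Psi>"
  using lower_diff[of \<alpha> \<alpha>v j w "\<lambda>v. word_weight \<alpha> v h * \<Psi> v" "\<lambda>v. c * \<Psi> v"]
  by (simp add: lower_weight lower_scale left_diff_distrib)

lemma lower_weight_add:
  "lower \<alpha> \<alpha>v j w (\<lambda>v. (word_weight \<alpha> v h + c) * \<Psi> v) =
     (word_weight \<alpha> w h - \<alpha> j h + c) * lower \<alpha> \<alpha>v j w \<Psi>"
  using lower_weight_diff[of \<alpha> \<alpha>v j w h "- c" \<Psi>] by simp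

text \<open>The functions that annihilate the two-sided ideal generated by the Serre elements, that
  is, the dual of the enveloping algebra of the positive part. The second alternative spells out
  [e_i, [e_i, e_j]], the element for the entry -1.\<close>

definition serre_invariant :: "'v set \<Rightarrow> ('v \<Rightarrow> 'v \<Rightarrow> int) \<Rightarrow> ('v list \<Rightarrow> complex) set" where
  "serre_invariant V B = {\<Psi>. \<forall>i\<in>V. \<forall>j\<in>V. i \<noteq> j \<longrightarrow> (\<forall>u v.
     if B i j = 0 then \<Psi> (u @ i # j # v) = \<Psi> (u @ j # i # v)
     else \<Psi> (u @ i # i # j # v) - 2 * \<Psi> (u @ i # j # i # v) + \<Psi> (u @ j # i # i # v) = 0)}"

lemma serre_invariantI:
  assumes "\<And>i j u v. i \<in> V \<Longrightarrow> j \<in> V \<Longrightarrow> i \<noteq> j \<Longrightarrow> B i j = 0 \<Longrightarrow>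
      \<Psi> (u @ i # j # v) = \<Psi> (u @ j # i # v)"
    and "\<And>i j u v. i \<in> V \<Longrightarrow> j \<in> V \<Longrightarrow> i \<noteq> j \<Longrightarrow> B i j \<noteq> 0 \<Longrightarrow>
      \<Psi> (u @ i # i # j # v) - 2 * \<Psi> (u @ i # j # i # v) + \<Psi> (u @ j # i # i # v) = 0"
  shows "\<Psi> \<in> serre_invariant V B"
  unfolding serre_invariant_def using assms by (intro CollectI ballI impI allI) auto

lemma serre_invariant_commute:
  "\<Psi> \<in> serre_invariant V B \<Longrightarrow> i \<in> V \<Longrightarrow> j \<in> V \<Longrightarrow> i \<noteq> j \<Longrightarrow> B i j = 0 \<Longrightarrow>
     \<Psi> (u @ i # j # v) = \<Psi> (u @ j # i # v)"
  unfolding serre_invariant_def by auto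

lemma serre_invariant_adjacent:
  "\<Psi> \<in> serre_invariant V B \<Longrightarrow> i \<in> V \<Longrightarrow> j \<in> V \<Longrightarrow> i \<noteq> j \<Longrightarrow> B i j \<noteq> 0 \<Longrightarrow>
     \<Psi> (u @ i # i # j # v) - 2 * \<Psi> (u @ i # j # i # v) + \<Psi> (u @ j # i # i # v) = 0"
  unfolding serre_invariant_def by auto

lemma serre_invariant_Cons:
  assumes "\<Psi> \<in> serre_invariant V B"
  shows "(\<lambda>w. \<Psi> (a # w)) \<in> serre_invariant V B"
  using serre_invariant_commute[OF assms, of _ _ "a # _"]
    serre_invariant_adjacent[OF assms, of _ _ "a # _"]
  by (intro serre_invariantI) simp_all

text \<open>Words range over the whole type, so linearity in h is demanded for indices outside
  \<open>V\<close> too.\<close>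

locale simply_laced_word_action =
  fixes hscale :: "complex \<Rightarrow> 'h::ab_group_add \<Rightarrow> 'h"
    and V :: "'v set" and B :: "'v \<Rightarrow> 'v \<Rightarrow> int"
    and \<alpha> :: "'v \<Rightarrow> 'h \<Rightarrow> complex" and \<alpha>v :: "'v \<Rightarrow> 'h"
  assumes root_add: "\<alpha> k (h + h') = \<alpha> k h + \<alpha> k h'"
    and root_scale: "\<alpha> k (hscale c h) = c * \<alpha> k h"
    and pairing: "i \<in> V \<Longrightarrow> j \<in> V \<Longrightarrow> \<alpha> j (\<alpha>v i) = of_int (B i j)"
    and B_diag: "i \<in> V \<Longrightarrow> B i i = 2"
    and B_off_diag: "i \<in> V \<Longrightarrow> j \<in> V \<Longrightarrow> i \<noteq> j \<Longrightarrow> B i j = 0 \<or> B i j = -1"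
    and B_sym: "i \<in> V \<Longrightarrow> j \<in> V \<Longrightarrow> B i j = B j i"
begin

lemma word_weight_root_add:
  "word_weight \<alpha> w (h + h') = word_weight \<alpha> w h + word_weight \<alpha> w h'"
  by (induction w) (simp_all add: root_add)

lemma word_weight_root_scale: "word_weight \<alpha> w (hscale c h) = c * word_weight \<alpha> w h"
  by (induction w) (simp_all add: root_scale algebra_simps)

lemma lower_serre_commute:
  assumes "i \<in> V" "j \<in> V" "i \<noteq> j" "B i j = 0"
  shows "lower \<alpha> \<alpha>v i w (\<lambda>v. lower \<alpha> \<alpha>v j v \<Psi>) = lower \<alpha> \<alpha>v j w (\<lambda>v. lower \<alpha> \<alpha>v i v \<Psi>)"
  using assms B_sym[of i j]
  by (induction w arbitrary: \<Psi>; simp add: lower_diff lower_weight lower_zero pairing;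
      simp add: algebra_simps)

text \<open>As in \<open>lower_serre_commute\<close>, a Serre element of the f_i commutes with each
  e_k even in the algebra without Serre relations. So it moves past the letters to the empty word,
  which it kills, whatever \<Psi> is.\<close>

lemma lower_serre_adjacent:
  assumes "i \<in> V" "j \<in> V" "i \<noteq> j" "B i j = -1"
  shows "lower \<alpha> \<alpha>v i w (\<lambda>v. lower \<alpha> \<alpha>v i v (\<lambda>u. lower \<alpha> \<alpha>v j u \<Psi>))
    - 2 * lower \<alpha> \<alpha>v i w (\<lambda>v. lower \<alpha> \<alpha>v j v (\<lambda>u. lower \<alpha> \<alpha>v i u \<Psi>))
    + lower \<alpha> \<alpha>v j w (\<lambda>v. lower \<alpha> \<alpha>v i v (\<lambda>u. lower \<alpha> \<alpha>v i u \<Psi>)) = 0"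
proof (induction w arbitrary: \<Psi>)
  case (Cons k w)
  have B: "B j i = -1" "B i i = 2" using assms B_sym[of i j] B_diag by auto
  consider "k = i" | "k = j" | "k \<noteq> i" "k \<noteq> j" by blast
  then show ?case
    using Cons[of "\<lambda>v. \<Psi> (k # v)"] assms B
    apply cases
      apply (simp_all add: lower_diff lower_weight lower_weight_diff lower_weight_add lower_zero pairing)
    apply (simp_all add: algebra_simps)
    done
qed simp

text \<open>The Serre ideal is stable under f_k: f_k commutes with the Serre elements of the e_i,
  and moving it past a prefix \<open>u\<close> leaves only multiples of elements of the
  ideal.\<close>

lemma lower_serre_invariant:
  assumes "\<Psi> \<in> serre_invariant V B"
  shows "(\<lambda>w. lower \<alpha> \<alpha>v k w \<Psi>) \<in> serre_invariant V B"
proof (rule serre_invariantI)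
  fix i j u v assume ij: "i \<in> V" "j \<in> V" "i \<noteq> j" "B i j = 0"
  have B: "B j i = 0" using ij B_sym[of i j] by simp
  from assms show "lower \<alpha> \<alpha>v k (u @ i # j # v) \<Psi> = lower \<alpha> \<alpha>v k (u @ j # i # v) \<Psi>"
  proof (induction u arbitrary: \<Psi>)
    case Nil
    have "(\<lambda>v. \<Psi> (i # j # v)) = (\<lambda>v. \<Psi> (j # i # v))"
      using serre_invariant_commute[OF Nil ij, of "[]"] by simp
    then show ?case
      using ij B by (auto simp: pairing)
  next
    case (Cons a u)
    then show ?case
      using Cons.IH[OF serre_invariant_Cons[OF Cons.prems, of a]]
        serre_invariant_commute[OF Cons.prems ij, of u v]
      by (simp add: word_weight_append algebra_simps)
  qed
next
  fix i j u v assume ij: "i \<in> V" "j \<in> V" "i \<noteq> j" "B i j \<noteq> 0"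
  have B: "B i j = -1" "B j i = -1" "B i i = 2"
    using ij B_sym[of i j] B_diag B_off_diag[OF ij(1-3)] by auto
  from assms show "lower \<alpha> \<alpha>v k (u @ i # i # j # v) \<Psi> - 2 * lower \<alpha> \<alpha>v k (u @ i # j # i # v) \<Psi>
      + lower \<alpha> \<alpha>v k (u @ j # i # i # v) \<Psi> = 0"
  proof (induction u arbitrary: \<Psi>)
    case Nil
    have "lower \<alpha> \<alpha>v k v (\<lambda>v. \<Psi> (i # i # j # v) - 2 * \<Psi> (i # j # i # v) + \<Psi> (j # i # i # v)) = 0"
      using serre_invariant_adjacent[OF Nil ij, of "[]"] by (simp add: lower_zero)
    then show ?case
      using ij B
      by (cases "k = i"; cases "k = j"; simp add: lower_add lower_diff lower_scale pairing;
          simp add: algebra_simps)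
  next
    case (Cons a u)
    \<comment> \<open>The three words of the relation have the same letters and hence a common
      weight, which factors out.\<close>
    let ?\<Psi> = "\<lambda>w. \<Psi> (a # w)" and ?W = "word_weight \<alpha> (u @ i # i # j # v) (\<alpha>v k)"
    have "lower \<alpha> \<alpha>v k ((a # u) @ i # i # j # v) \<Psi> - 2 * lower \<alpha> \<alpha>v k ((a # u) @ i # j # i # v) \<Psi>
        + lower \<alpha> \<alpha>v k ((a # u) @ j # i # i # v) \<Psi> =
      (lower \<alpha> \<alpha>v k (u @ i # i # j # v) ?\<Psi> - 2 * lower \<alpha> \<alpha>v k (u @ i # j # i # v) ?\<Psi>
        + lower \<alpha> \<alpha>v k (u @ j # i # i # v) ?\<Psi>) - (if a = k then
          ?W * (\<Psi> (u @ i # i # j # v) - 2 * \<Psi> (u @ i # j # i # v) + \<Psi> (u @ j # i # i # v)) else 0)"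
      by (simp add: word_weight_append algebra_simps)
    also have "\<dots> = 0"
      using Cons.IH[OF serre_invariant_Cons[OF Cons.prems, of a]]
        serre_invariant_adjacent[OF Cons.prems ij, of u v] by (simp only:) simp
    finally show ?case .
  qed
qed

text \<open>Transposition reverses products and so negates commutators; the minus sign in the
  operator of \<open>H\<close> compensates for this.\<close>

lemma lie_action_word_act:
  assumes "\<And>i h. i \<in> V \<Longrightarrow> \<alpha>' i h = \<alpha> i h"
  shows "lie_action (word_act \<alpha> \<alpha>v) (serre_invariant V B) (chevalley_serre hscale V B \<alpha>' \<alpha>v)"
proof
  fix x c and \<Phi> \<Psi> :: "'v list \<Rightarrow> complex"
  show "word_act \<alpha> \<alpha>v x (\<lambda>w. \<Phi> w + \<Psi> w) = (\<lambda>w. word_act \<alpha> \<alpha>v x \<Phi> w + word_act \<alpha> \<alpha>v x \<Psi> w)"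
    by (cases x) (simp_all add: lower_add algebra_simps)
  show "word_act \<alpha> \<alpha>v x (\<lambda>w. c * \<Psi> w) = (\<lambda>w. c * word_act \<alpha> \<alpha>v x \<Psi> w)"
    by (cases x) (simp_all add: lower_scale algebra_simps)
  show "(\<lambda>w. c * \<Psi> w) \<in> serre_invariant V B" if inv: "\<Psi> \<in> serre_invariant V B"
  proof (rule serre_invariantI)
    fix i j u v assume ij: "i \<in> V" "j \<in> V" "i \<noteq> j" "B i j \<noteq> 0"
    have "c * \<Psi> (u @ i # i # j # v) - 2 * (c * \<Psi> (u @ i # j # i # v)) + c * \<Psi> (u @ j # i # i # v) =
        c * (\<Psi> (u @ i # i # j # v) - 2 * \<Psi> (u @ i # j # i # v) + \<Psi> (u @ j # i # i # v))"
      by (simp add: algebra_simps)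
    then show "c * \<Psi> (u @ i # i # j # v) - 2 * (c * \<Psi> (u @ i # j # i # v))
        + c * \<Psi> (u @ j # i # i # v) = 0"
      using serre_invariant_adjacent[OF inv ij, of u v] by simp
  next
    fix i j u v assume ij: "i \<in> V" "j \<in> V" "i \<noteq> j" "B i j = 0"
    show "c * \<Psi> (u @ i # j # v) = c * \<Psi> (u @ j # i # v)"
      using serre_invariant_commute[OF inv ij, of u v] by simp
  qed
  show "(\<lambda>w. \<Phi> w + \<Psi> w) \<in> serre_invariant V B"
    if inv: "\<Phi> \<in> serre_invariant V B" "\<Psi> \<in> serre_invariant V B"
  proof (rule serre_invariantI)
    fix i j u v assume ij: "i \<in> V" "j \<in> V" "i \<noteq> j" "B i j \<noteq> 0"
    show "\<Phi> (u @ i # i # j # v) + \<Psi> (u @ i # i # j # v)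
        - 2 * (\<Phi> (u @ i # j # i # v) + \<Psi> (u @ i # j # i # v))
        + (\<Phi> (u @ j # i # i # v) + \<Psi> (u @ j # i # i # v)) = 0"
      using inv[THEN serre_invariant_adjacent, OF ij, of u v] by (simp add: algebra_simps)
  next
    fix i j u v assume ij: "i \<in> V" "j \<in> V" "i \<noteq> j" "B i j = 0"
    show "\<Phi> (u @ i # j # v) + \<Psi> (u @ i # j # v) = \<Phi> (u @ j # i # v) + \<Psi> (u @ j # i # v)"
      using inv[THEN serre_invariant_commute, OF ij, of u v] by simp
  qed
next
  fix x and \<Psi> :: "'v list \<Rightarrow> complex"
  assume inv: "\<Psi> \<in> serre_invariant V B"
  show "word_act \<alpha> \<alpha>v x \<Psi> \<in> serre_invariant V B"
  proof (cases x)
    case (E a)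
    then show ?thesis
      using serre_invariant_Cons[OF inv] by simp
  next
    case (F a)
    then show ?thesis using lower_serre_invariant[OF inv] by simp
  next
    case (H h)
    have "(\<lambda>w. - word_weight \<alpha> w h * \<Psi> w) \<in> serre_invariant V B"
    proof (rule serre_invariantI)
      fix i j u v assume ij: "i \<in> V" "j \<in> V" "i \<noteq> j" "B i j = 0"
      show "- word_weight \<alpha> (u @ i # j # v) h * \<Psi> (u @ i # j # v) =
          - word_weight \<alpha> (u @ j # i # v) h * \<Psi> (u @ j # i # v)"
        using serre_invariant_commute[OF inv ij, of u v]
        by (simp add: word_weight_append algebra_simps)
    next
      fix i j u v assume ij: "i \<in> V" "j \<in> V" "i \<noteq> j" "B i j \<noteq> 0"
      have "- word_weight \<alpha> (u @ i # i # j # v) h * \<Psi> (u @ i # i # j # v)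
          - 2 * (- word_weight \<alpha> (u @ i # j # i # v) h * \<Psi> (u @ i # j # i # v))
          + - word_weight \<alpha> (u @ j # i # i # v) h * \<Psi> (u @ j # i # i # v) =
        - word_weight \<alpha> (u @ i # i # j # v) h *
          (\<Psi> (u @ i # i # j # v) - 2 * \<Psi> (u @ i # j # i # v) + \<Psi> (u @ j # i # i # v))"
        by (simp add: word_weight_append algebra_simps)
      then show "- word_weight \<alpha> (u @ i # i # j # v) h * \<Psi> (u @ i # i # j # v)
          - 2 * (- word_weight \<alpha> (u @ i # j # i # v) h * \<Psi> (u @ i # j # i # v))
          + - word_weight \<alpha> (u @ j # i # i # v) h * \<Psi> (u @ j # i # i # v) = 0"
        using serre_invariant_adjacent[OF inv ij, of u v] by simp
    qed
    then show ?thesis using H by simp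
  qed
next
  fix s t and \<Psi> :: "'v list \<Rightarrow> complex"
  assume "(s, t) \<in> chevalley_serre hscale V B \<alpha>' \<alpha>v" and inv: "\<Psi> \<in> serre_invariant V B"
  then show "term_act (word_act \<alpha> \<alpha>v) s \<Psi> = term_act (word_act \<alpha> \<alpha>v) t \<Psi>"
  proof cases
    case (Serre_E i j)
    then consider "B i j = 0" | "B i j = -1" using B_off_diag by blast
    then show ?thesis
    proof cases
      case 1
      then show ?thesis
        using Serre_E serre_invariant_commute[OF inv, of i j "[]"] by (simp add: fun_eq_iff)
    next
      case 2
      have "\<Psi> (i # i # j # v) - 2 * \<Psi> (i # j # i # v) + \<Psi> (j # i # i # v) = 0" for v
        using Serre_E 2 serre_invariant_adjacent[OF inv, of i j "[]"] by simp
      then show ?thesis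
        using 2 Serre_E by (simp add: numeral_2_eq_2 algebra_simps fun_eq_iff)
    qed
  next
    case (Serre_F i j)
    then consider "B i j = 0" | "B i j = -1" using B_off_diag by blast
    then show ?thesis
    proof cases
      case 1
      then show ?thesis
        using Serre_F lower_serre_commute[of i j] by (simp add: fun_eq_iff)
    next
      case 2
      then show ?thesis
        using Serre_F lower_serre_adjacent[of i j]
        by (simp add: numeral_2_eq_2 lower_diff algebra_simps fun_eq_iff)
    qed
  next
    case (H_F i h)
    have "lower \<alpha> \<alpha>v i w (\<lambda>v. - (word_weight \<alpha> v h * \<Psi> v)) =
        - ((word_weight \<alpha> w h - \<alpha> i h) * lower \<alpha> \<alpha>v i w \<Psi>)" for w
      using lower_scale[of \<alpha> \<alpha>v i w "-1" "\<lambda>v. word_weight \<alpha> v h * \<Psi> v"] by (simp add: lower_weight)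
    then show ?thesis
      using H_F assms[of i h] by (simp add: fun_eq_iff left_diff_distrib)
  qed (simp_all add: word_weight_root_add word_weight_root_scale assms algebra_simps fun_eq_iff)
qed

end

section \<open>Multiplicities of sums of distinct simple roots\<close>

lemma (in simple_adjacency) rooted_words_swap:
  assumes "\<not> adj i j" "i \<noteq> j"
  shows "u @ i # j # v \<in> rooted_words adj r S \<longleftrightarrow> u @ j # i # v \<in> rooted_words adj r S"
proof -
  have *: "rooted_word adj (u @ i # j # v) \<longleftrightarrow> rooted_word adj (u @ j # i # v)"
    using assms adj_sym[of j i] by (induction u) auto
  \<comment> \<open>Only with \<open>v\<close> empty could the swap change the last letter, but then
    \<open>i\<close> has no later neighbour.\<close>
  have "\<not> rooted_word adj (u @ [i, j])"
    using assms by (induction u) auto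
  then have "last (u @ i # j # v) = last (u @ j # i # v)" if "rooted_word adj (u @ i # j # v)"
    using that by (cases "v = []") auto
  then show ?thesis
    using * by (auto simp: rooted_words_def)
qed

lemma (in simple_adjacency) orient_swap:
  "\<not> adj i j \<Longrightarrow> orient adj (u @ i # j # v) = orient adj (u @ j # i # v)"
  using adj_sym[of j i] by (auto simp: orient_append)

text \<open>The reversal is forced: acting with e_i after e_j evaluates \<Psi> at words that begin
  with \<open>j\<close>, \<open>i\<close>.\<close>

definition orientation_indicator ::
  "('v \<Rightarrow> 'v \<Rightarrow> bool) \<Rightarrow> 'v \<Rightarrow> 'v set \<Rightarrow> ('v \<times> 'v) set \<Rightarrow> 'v list \<Rightarrow> complex" where
  "orientation_indicator adj r S ori w =
     of_bool (rev w \<in> rooted_words adj r S \<and> orient adj (rev w) = ori)"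

text \<open>Swapping neighbouring commuting letters preserves the orientation. In the three-term
  relation every word repeats \<open>i\<close>, so all terms are 0.\<close>

lemma (in simple_adjacency) orientation_indicator_serre_invariant:
  assumes "\<And>i j. i \<in> V \<Longrightarrow> j \<in> V \<Longrightarrow> i \<noteq> j \<Longrightarrow> B i j = 0 \<longleftrightarrow> \<not> adj i j"
  shows "orientation_indicator adj r S ori \<in> serre_invariant V B"
proof (rule serre_invariantI)
  fix i j u v assume "i \<in> V" "j \<in> V" "i \<noteq> j" "B i j = 0"
  then have "\<not> adj i j" "i \<noteq> j" using assms by auto
  then show "orientation_indicator adj r S ori (u @ i # j # v) =
      orientation_indicator adj r S ori (u @ j # i # v)"
    using rooted_words_swap[of i j "rev v" "rev u" r S] orient_swap[of i j "rev v" "rev u"]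
    by (simp add: orientation_indicator_def)
next
  fix i j u v
  have "orientation_indicator adj r S ori w = 0" if "\<not> distinct w" for w
    using that rooted_word_distinct[of adj "rev w"]
    by (auto simp: orientation_indicator_def rooted_words_def)
  then show "orientation_indicator adj r S ori (u @ i # i # j # v)
      - 2 * orientation_indicator adj r S ori (u @ i # j # i # v)
      + orientation_indicator adj r S ori (u @ j # i # i # v) = 0"
    by simp
qed

text \<open>Expanding the nested bracket of \<open>w\<close> in the enveloping algebra, \<open>w\<close> itself is the only word
  that ends with the last letter of \<open>w\<close>; the action reverses words.\<close>

lemma (in simply_laced_word_action) term_act_word_term:
  assumes "lie_action (word_act \<alpha> \<alpha>v) K R"
    and "w \<noteq> []" "distinct w" "\<And>i v. i \<noteq> last w \<Longrightarrow> \<Psi> (i # v) = 0"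
  shows "term_act (word_act \<alpha> \<alpha>v) (word_term E w) \<Psi> v = \<Psi> (rev w @ v)"
proof -
  interpret lie_action "word_act \<alpha> \<alpha>v" K R by fact
  show ?thesis
    using assms(2-4)
  proof (induction "E :: 'v \<Rightarrow> ('v, 'h) km_gen" w arbitrary: v rule: word_term.induct)
    case (3 i j w)
    have "i \<noteq> last (i # j # w)"
      using "3.prems"(2) last_in_set[of "j # w"] by auto
    \<comment> \<open>This kills the half of the commutator in which e_i acts first.\<close>
    then have "(\<lambda>v. \<Psi> (i # v)) = (\<lambda>v. 0)"
      using "3.prems"(3) by auto
    then show ?case
      using 3 by (simp add: term_act_zero)
  qed simp_all
qed

locale simply_laced_kac_moody =
  kac_moody_algebra hscale V B \<alpha> \<alpha>v scale bracket \<gamma> + simple_adjacency adj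
  for hscale :: "complex \<Rightarrow> 'h::ab_group_add \<Rightarrow> 'h"
    and V :: "'v set" and B :: "'v \<Rightarrow> 'v \<Rightarrow> int"
    and \<alpha> :: "'v \<Rightarrow> 'h \<Rightarrow> complex" and \<alpha>v :: "'v \<Rightarrow> 'h"
    and scale :: "complex \<Rightarrow> 'g::ab_group_add \<Rightarrow> 'g"
    and bracket :: "'g \<Rightarrow> 'g \<Rightarrow> 'g"
    and \<gamma> :: "('v, 'h) km_gen \<Rightarrow> 'g"
    and adj :: "'v \<Rightarrow> 'v \<Rightarrow> bool" +
  assumes B_adj: "i \<in> V \<Longrightarrow> j \<in> V \<Longrightarrow> B i j = 2 * of_bool (i = j) - of_bool (adj i j)"
begin

lemma bracket_E_E:
  assumes "i \<in> V" "j \<in> V" "\<not> adj i j"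
  shows "bracket (\<gamma> (E i)) (\<gamma> (E j)) = 0"
proof (cases "i = j")
  case True
  then show ?thesis by (simp add: g.bracket_self)
next
  case False
  then show ?thesis
    using relation_holds[OF Serre_E[OF assms(1,2) False]] assms by (simp add: B_adj)
qed

text \<open>A letter without a later neighbour commutes with every later letter, hence with their
  nested bracket.\<close>

lemma e_word_not_rooted:
  assumes "w \<noteq> []" "distinct w" "set w \<subseteq> V" "\<not> rooted_word adj w"
  shows "e_word w = 0"
  using assms
proof (induction w)
  case (Cons a w)
  then have ne: "w \<noteq> []" by auto
  show ?case
  proof (cases "\<exists>b\<in>set w. adj a b")
    case True
    then show ?thesis using Cons ne by (simp add: g.nested_Cons)
  next
    case False
    then have "bracket (\<gamma> (E a)) (e_word w) = 0"
      using Cons.prems by (intro g.nested_commute bracket_E_E) auto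
    then show ?thesis using ne by (simp add: g.nested_Cons)
  qed
qed simp

text \<open>Linear extensions of one orientation differ by commutations: the first letter
  \<open>a\<close> of \<open>w\<close> is a source, so no letter before it in \<open>w'\<close> is
  adjacent to it, and it can be moved to the front. Equal last letters ensure that something remains
  behind \<open>a\<close>.\<close>

lemma e_word_orient_cong:
  assumes "distinct w" "distinct w'" "set w = set w'" "set w \<subseteq> V" "last w = last w'"
    and "orient adj w = orient adj w'"
  shows "e_word w = e_word w'"
  using assms
proof (induction w arbitrary: w')
  case (Cons a u)
  show ?case
  proof (cases "u = []")
    case True
    then have "w' = [a]"
      using Cons.prems by (cases w'; cases "tl w'") auto
    then show ?thesis using True by simp
  next
    case False
    have "a \<in> set w'" using Cons.prems(3) by auto
    then obtain p s where w': "w' = p @ a # s" by (auto simp: in_set_conv_decomp)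
    have "a \<noteq> last w'"
      using Cons.prems(1,5) False last_in_set[of u] by auto
    then have s: "s \<noteq> []" using w' by auto
    have not_adj: "\<not> adj a b" if b: "b \<in> set p" for b
    proof
      assume "adj a b"
      then have "(b, a) \<in> orient adj (a # u)"
        using b adj_sym Cons.prems(6) w' by (auto simp: orient_append)
      moreover have "b \<noteq> a" using b Cons.prems(2) w' by auto
      ultimately show False
        using Cons.prems(1) orient_subset[of b a adj u] by auto
    qed
    have "filter (\<lambda>x. x \<noteq> a) u = u" "filter (\<lambda>x. x \<noteq> a) p = p" "filter (\<lambda>x. x \<noteq> a) s = s"
      using Cons.prems(1,2) w' by (auto intro!: filter_True)
    then have filt: "filter (\<lambda>x. x \<noteq> a) (a # u) = u" "filter (\<lambda>x. x \<noteq> a) w' = p @ s"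
      using w' by simp_all
    have "orient adj (filter (\<lambda>x. x \<noteq> a) (a # u)) = orient adj (filter (\<lambda>x. x \<noteq> a) w')"
      unfolding orient_filter Cons.prems(6) ..
    then have "orient adj u = orient adj (p @ s)"
      unfolding filt .
    moreover have "set (filter (\<lambda>x. x \<noteq> a) (a # u)) = set (filter (\<lambda>x. x \<noteq> a) w')"
      unfolding set_filter Cons.prems(3) ..
    then have "set u = set (p @ s)"
      unfolding filt .
    ultimately have "e_word u = e_word (p @ s)"
      using Cons.prems False s w' by (intro Cons.IH) auto
    then have "e_word (a # u) = e_word (a # p @ s)"
      using False s by (simp add: g.nested_Cons)
    also have "\<dots> = e_word w'"
      unfolding w' using s not_adj Cons.prems(3,4) w'
      by (intro g.nested_move_front[symmetric] bracket_E_E) auto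
    finally show ?thesis .
  qed
qed simp

text \<open>The functional lets an element act on the indicator of the orientation and evaluates at
  the empty word, which stands for the lowest weight vector.\<close>

lemma orientation_functional:
  obtains \<phi> where "\<And>x y. \<phi> (x + y) = \<phi> x + \<phi> y" "\<And>c x. \<phi> (scale c x) = c * \<phi> x"
    "\<And>w. w \<in> rooted_words adj r S \<Longrightarrow> S \<subseteq> V \<Longrightarrow> \<phi> (e_word w) = (of_bool (orient adj w = ori) :: complex)"
proof -
  \<comment> \<open>Nothing is known about \<open>\<alpha>\<close> outside \<open>V\<close>; the
    value 0 makes it linear there.\<close>
  let ?a = "\<lambda>i. if i \<in> V then \<alpha> i else (\<lambda>_. 0)"
  let ?D = "word_act ?a \<alpha>v" and ?ev = "lie_eval scale bracket \<gamma>"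
  let ?\<Psi> = "orientation_indicator adj r S ori"
  interpret w: simply_laced_word_action hscale V B ?a \<alpha>v
  proof
    fix k h h' c
    show "?a k (h + h') = ?a k h + ?a k h'" "?a k (hscale c h) = c * ?a k h"
      using roots_linear[of k] unfolding Vector_Spaces.linear_iff_module_hom
      by (auto simp: module_hom.add module_hom.scale)
  qed (auto simp: pairing B_adj adj_irrefl dest: adj_sym)
  let ?R = "chevalley_serre hscale V B \<alpha> \<alpha>v"
  have act: "lie_action ?D (serre_invariant V B) ?R"
    by (rule w.lie_action_word_act) simp
  interpret lie_action ?D "serre_invariant V B" ?R by (rule act)
  have \<Psi>: "?\<Psi> \<in> serre_invariant V B"
    by (rule orientation_indicator_serre_invariant) (simp add: B_adj)
  have surj: "?ev ` {t. gens t \<subseteq> km_gens V} = UNIV"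
    and eq: "\<And>s t. gens s \<subseteq> km_gens V \<Longrightarrow> gens t \<subseteq> km_gens V \<Longrightarrow> ?ev s = ?ev t \<Longrightarrow> lie_eq ?R s t"
    using presentation unfolding lie_presentation_def by auto
  define \<tau> where "\<tau> x = (SOME t. gens t \<subseteq> km_gens V \<and> ?ev t = x)" for x
  have \<tau>: "gens (\<tau> x) \<subseteq> km_gens V" "?ev (\<tau> x) = x" for x
  proof -
    have "\<exists>t. gens t \<subseteq> km_gens V \<and> ?ev t = x"
      using surj by (metis (mono_tags, lifting) UNIV_I imageE mem_Collect_eq)
    then show "gens (\<tau> x) \<subseteq> km_gens V" "?ev (\<tau> x) = x"
      unfolding \<tau>_def by (metis (mono_tags, lifting) someI_ex)+
  qed
  define \<phi> where "\<phi> x = term_act ?D (\<tau> x) ?\<Psi> []" for x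
  \<comment> \<open>The choice of a term for each element is harmless: terms with equal value are
    congruent and act alike on invariant functions.\<close>
  have \<phi>: "\<phi> (?ev t) = term_act ?D t ?\<Psi> []" if "gens t \<subseteq> km_gens V" for t
    unfolding \<phi>_def using lie_eq_term_act[OF eq \<Psi>, of "\<tau> (?ev t)" t] \<tau> that by simp
  show thesis
  proof (rule that)
    fix x y
    show "\<phi> (x + y) = \<phi> x + \<phi> y"
      using \<phi>[of "Plus (\<tau> x) (\<tau> y)"] \<tau> by (simp add: \<phi>_def[of x] \<phi>_def[of y])
  next
    fix c x
    show "\<phi> (scale c x) = c * \<phi> x"
      using \<phi>[of "Smult c (\<tau> x)"] \<tau> by (simp add: \<phi>_def[of x])
  next
    fix w assume w: "w \<in> rooted_words adj r S" and S: "S \<subseteq> V"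
    have rw: "rooted_word adj w" "set w = S" "last w = r"
      using w by (auto simp: rooted_words_def)
    have gens: "gens (word_term E w) \<subseteq> km_gens V" if "set w \<subseteq> V" for w :: "'v list"
      using that by (induction "E :: 'v \<Rightarrow> ('v, 'h) km_gen" w rule: word_term.induct)
        (auto simp: km_gens_def)
    have "\<phi> (e_word w) = term_act ?D (word_term E w) ?\<Psi> []"
      unfolding g.lie_eval_word_term[symmetric] using rw S by (intro \<phi> gens) auto
    also have "\<dots> = ?\<Psi> (rev w @ [])"
      \<comment> \<open>The indicator vanishes on words not beginning with \<open>r\<close>, because
        a reversed rooted word begins with its sink.\<close>
      using rw rooted_word_distinct[OF rw(1)]
      by (intro w.term_act_word_term[OF act])
        (auto simp: orientation_indicator_def rooted_words_def)
    also have "\<dots> = of_bool (orient adj w = ori)"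
      using w by (simp add: orientation_indicator_def)
    finally show "\<phi> (e_word w) = of_bool (orient adj w = ori)" .
  qed
qed

text \<open>For words with sink \<open>r\<close>, equal brackets mean equal orientations, and the
  functionals serve as a dual basis. If the induced graph is disconnected, both sides are 0.\<close>

lemma root_mult_root_sum:
  assumes S: "S \<subseteq> V" "r \<in> S"
  shows "root_mult scale bracket \<gamma> (root_sum \<alpha> S) = card (orientations adj r S)"
proof -
  let ?W = "rooted_words adj r S" and ?X = "e_word ` rooted_words adj r S"
  have fin: "finite ?W"
    using S finite_V by (intro finite_rooted_words) (rule finite_subset)
  have eq_iff: "e_word w = e_word w' \<longleftrightarrow> orient adj w = orient adj w'" if w: "w \<in> ?W" "w' \<in> ?W" for w w'
  proof
    assume eq: "e_word w = e_word w'"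
    obtain \<phi> where "\<And>u. u \<in> ?W \<Longrightarrow> S \<subseteq> V \<Longrightarrow> \<phi> (e_word u) = (of_bool (orient adj u = orient adj w) :: complex)"
      using orientation_functional[where r = r and S = S and ori = "orient adj w"] by metis
    from this[OF w(1)] this[OF w(2)] show "orient adj w = orient adj w'"
      using eq S by (auto split: if_splits)
  next
    assume "orient adj w = orient adj w'"
    then show "e_word w = e_word w'"
      using w S by (intro e_word_orient_cong) (auto simp: rooted_words_def rooted_word_distinct)
  qed
  \<comment> \<open>Several words may give one vector; by \<open>eq_iff\<close> the chosen
    representative does not affect the orientation.\<close>
  have "bij_betw (\<lambda>x. orient adj (inv_into ?W e_word x)) ?X (orientations adj r S)"
  proof (rule bij_betwI')
    fix x y assume "x \<in> ?X" "y \<in> ?X"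
    then show "orient adj (inv_into ?W e_word x) = orient adj (inv_into ?W e_word y) \<longleftrightarrow> x = y"
      using eq_iff[of "inv_into ?W e_word x" "inv_into ?W e_word y"]
      by (simp add: inv_into_into f_inv_into_f)
  next
    fix x assume "x \<in> ?X"
    then show "orient adj (inv_into ?W e_word x) \<in> orientations adj r S"
      unfolding orientations_def by (intro imageI inv_into_into)
  next
    fix ori assume "ori \<in> orientations adj r S"
    then obtain w where w: "w \<in> ?W" "ori = orient adj w" by (auto simp: orientations_def)
    then have "ori = orient adj (inv_into ?W e_word (e_word w))"
      using eq_iff[of w "inv_into ?W e_word (e_word w)"] by (simp add: inv_into_into f_inv_into_f)
    then show "\<exists>x\<in>?X. ori = orient adj (inv_into ?W e_word x)"
      using w(1) by blast
  qed
  then have card: "card ?X = card (orientations adj r S)"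
    by (rule bij_betw_same_card)
  have "g.independent ?X"
  proof
    assume "g.dependent ?X"
    then obtain u v where v: "v \<in> ?X" "u v \<noteq> 0" and sum: "(\<Sum>x\<in>?X. scale (u x) x) = 0"
      using fin by (auto simp: g.dependent_finite)
    obtain w where w: "w \<in> ?W" "v = e_word w" using v(1) by auto
    obtain \<phi> where add: "\<And>x y. \<phi> (x + y) = \<phi> x + \<phi> y" and scal: "\<And>c x. \<phi> (scale c x) = c * \<phi> x"
      and \<phi>: "\<And>u. u \<in> ?W \<Longrightarrow> S \<subseteq> V \<Longrightarrow> \<phi> (e_word u) = (of_bool (orient adj u = orient adj w) :: complex)"
      using orientation_functional[where r = r and S = S and ori = "orient adj w"] by metis
    have zero: "\<phi> 0 = 0" using scal[of 0 0] by simp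
    have \<phi>_X: "\<phi> x = of_bool (x = v)" if "x \<in> ?X" for x
      using that \<phi> S w eq_iff by auto
    have "\<phi> (\<Sum>x\<in>A. scale (u x) x) = (\<Sum>x\<in>A. u x * \<phi> x)" for A
      by (induction A rule: infinite_finite_induct) (simp_all add: zero add scal)
    then have "0 = (\<Sum>x\<in>?X. u x * \<phi> x)" using sum zero by metis
    also have "\<dots> = (\<Sum>x\<in>?X. if x = v then u x else 0)"
    proof (rule sum.cong[OF HOL.refl])
      fix x assume "x \<in> ?X"
      then show "u x * \<phi> x = (if x = v then u x else 0)"
        using \<phi>_X[of x] by (cases "x = v") simp_all
    qed
    also have "\<dots> = u v" using fin v(1) by simp
    finally show False using v(2) by simp
  qed
  moreover have "weight_space (root_sum \<alpha> S) = g.span ?X"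
  proof -
    have "g.span {e_word w | w. distinct w \<and> set w = S} = g.span ?X"
    proof (rule subset_antisym)
      show "g.span ?X \<subseteq> g.span {e_word w | w. distinct w \<and> set w = S}"
        by (rule g.span_mono) (auto simp: rooted_words_def rooted_word_distinct)
      show "g.span {e_word w | w. distinct w \<and> set w = S} \<subseteq> g.span ?X"
      proof (rule g.span_minimal[OF _ g.subspace_span], clarify)
        fix w assume w: "distinct w" "S = set w"
        have "e_word w \<in> g.span {e_word w' | w'. mset w' = mset w \<and> last w' = r}"
          using w S by (intro g.nested_span_last) auto
        \<comment> \<open>The words with last letter \<open>r\<close> that are not rooted contribute
          only 0.\<close>
        also have "\<dots> \<subseteq> g.span (insert 0 ?X)"
        proof (rule g.span_mono, rule subsetI)
          fix x assume "x \<in> {e_word w' | w'. mset w' = mset w \<and> last w' = r}"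
          then obtain w' where w': "x = e_word w'" "mset w' = mset w" "last w' = r" by auto
          have d: "distinct w'" "set w' = S"
            using w'(2) w by (metis mset_eq_imp_distinct_iff, metis mset_eq_setD)
          then have "w' \<noteq> []" using S by auto
          then show "x \<in> insert 0 ?X"
            using e_word_not_rooted[of w'] w' d S by (auto simp: rooted_words_def)
        qed
        finally show "e_word w \<in> g.span (e_word ` rooted_words adj r (set w))"
          using w by simp
      qed
    qed
    moreover have "S \<noteq> {}" using S by auto
    ultimately show ?thesis using root_space_root_sum[OF S(1)] by simp
  qed
  ultimately show ?thesis
    unfolding root_mult_def card[symmetric] by (simp add: g.dim_eq_card_independent)
qed

end

section \<open>The Moebius function of the bond lattice\<close>

lemma (in simple_adjacency) rooted_word_rtrancl:
  assumes "rooted_word adj w" "u \<in> set w" "v \<in> set w"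
  shows "(u, v) \<in> {(x, y). x \<in> set w \<and> y \<in> set w \<and> adj x y}\<^sup>*"
  using assms
proof (induction w arbitrary: u v)
  case (Cons a w)
  let ?R = "\<lambda>w. {(x, y). x \<in> set w \<and> y \<in> set w \<and> adj x y}"
  show ?case
  proof (cases "w = []")
    case True
    then show ?thesis using Cons.prems by simp
  next
    case False
    have IH: "(u, v) \<in> (?R (a # w))\<^sup>*" if "u \<in> set w" "v \<in> set w" for u v
      using Cons.IH[OF _ that] Cons.prems(1) False rtrancl_mono[of "?R w" "?R (a # w)"] by auto
    obtain b where b: "b \<in> set w" "adj a b"
      using Cons.prems(1) False by auto
    then have ab: "(a, b) \<in> ?R (a # w)" "(b, a) \<in> ?R (a # w)"
      using adj_sym by auto
    have "(u, b) \<in> (?R (a # w))\<^sup>*"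
      using Cons.prems(2) IH[OF _ b(1)] ab(1) by (cases "u = a") auto
    moreover have "(b, v) \<in> (?R (a # w))\<^sup>*"
      using Cons.prems(3) IH[OF b(1)] ab(2) by (cases "v = a") auto
    ultimately show ?thesis
      by (rule rtrancl_trans)
  qed
qed simp

section \<open>Connectedness and refinement in the graph\<close>

context pair_graph
begin

abbreviation adjacent :: "'a \<Rightarrow> 'a \<Rightarrow> bool" where
  "adjacent x y \<equiv> (x, y) \<in> parcs G"

lemma adjacent_sym: "adjacent x y \<Longrightarrow> adjacent y x"
  using pair_sym_arcs by (auto simp: symmetric_def dest: symD)

text \<open>\<open>connected\<close> means strong connectedness of the symmetric closure; the arcs
  here are already symmetric, so the closure adds none.\<close>

lemma parcs_mk_symmetric_induce:
  "parcs (mk_symmetric (with_proj G \<restriction> S)) = {(x, y). x \<in> S \<and> y \<in> S \<and> adjacent x y}"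
  using adjacent_sym by (force simp: parcs_mk_symmetric)

lemma simple_adjacency_adjacent: "simple_adjacency adjacent"
  by unfold_locales (auto intro: adjacent_sym dest: no_loops)

lemma connected_rooted_word:
  assumes "rooted_word adjacent w"
  shows "Digraph_Component.connected (with_proj G \<restriction> set w)"
  unfolding connected_def strongly_connected_def
proof (intro conjI ballI)
  show "verts (with_proj (mk_symmetric (with_proj G \<restriction> set w))) \<noteq> {}"
    using assms by auto
next
  fix u v
  assume "u \<in> verts (with_proj (mk_symmetric (with_proj G \<restriction> set w)))"
    and "v \<in> verts (with_proj (mk_symmetric (with_proj G \<restriction> set w)))"
  then have uv: "u \<in> set w" "v \<in> set w" by simp_all
  show "u \<rightarrow>\<^sup>*\<^bsub>with_proj (mk_symmetric (with_proj G \<restriction> set w))\<^esub> v"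
    unfolding reachable_def with_proj_simps pverts_mk_symmetric induce_subgraph_verts
      parcs_mk_symmetric_induce
    using simple_adjacency.rooted_word_rtrancl[OF simple_adjacency_adjacent assms uv] uv
    by (rule rtrancl_consistent_rtrancl_on) auto
qed

lemma connected_obtain_edge:
  assumes "Digraph_Component.connected (with_proj G \<restriction> S)" "u \<in> S" "v \<in> S" "u \<noteq> v"
  obtains x y where "x \<in> S" "y \<in> S" "adjacent x y"
proof -
  have "u \<rightarrow>\<^sup>*\<^bsub>with_proj (mk_symmetric (with_proj G \<restriction> S))\<^esub> v"
    using assms by (simp add: connected_def strongly_connected_def)
  then have "(u, v) \<in> {(x, y). x \<in> S \<and> y \<in> S \<and> adjacent x y}\<^sup>*"
    by (auto dest: reachable_rtranclI simp: parcs_mk_symmetric_induce)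
  then show thesis
    using assms(4) that by (cases rule: converse_rtranclE) auto
qed

lemma bond_bottom_in_bond_partitions: "bond_bottom G \<in> bond_partitions G"
proof -
  have "Digraph_Component.connected (with_proj G \<restriction> {v})" for v
    using connected_rooted_word[of "[v]"] by simp
  then show ?thesis
    using partition_on_singletons by (auto simp: bond_partitions_def bond_bottom_def)
qed

lemma finite_bond_order: "finite (bond_order G)"
proof -
  have "finite (bond_partitions G)"
    using finitely_many_partition_on[OF pair_finite_verts]
    by (rule rev_finite_subset) (auto simp: bond_partitions_def)
  then have "finite (bond_partitions G \<times> bond_partitions G)" by simp
  then show ?thesis
    by (rule rev_finite_subset) (auto simp: bond_order_def)
qed

lemma partial_order_on_bond_order: "partial_order_on (Field (bond_order G)) (bond_order G)"
  unfolding partial_order_on_def preorder_on_def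
proof (intro conjI)
  show "refl_on (Field (bond_order G)) (bond_order G)"
    by (auto simp: refl_on_def Field_def bond_order_def bond_partitions_def intro: refines_refl)
  show "trans (bond_order G)"
    by (auto simp: trans_def bond_order_def intro: refines_trans)
  show "antisym (bond_order G)"
    unfolding antisym_def bond_order_def using refines_asym by blast
  show "bond_order G \<subseteq> Field (bond_order G) \<times> Field (bond_order G)"
    by (auto simp: Field_def)
qed

lemma bond_bottom_le: "\<pi> \<in> bond_partitions G \<Longrightarrow> (bond_bottom G, \<pi>) \<in> bond_order G"
  using bond_bottom_in_bond_partitions
  by (auto simp: bond_order_def refines_def bond_partitions_def bond_bottom_def partition_on_def)

section \<open>Summing over the refinements of a bond partition\<close>

context
  fixes m :: "'a set \<Rightarrow> int"
  assumes m: "\<And>r T. r \<in> T \<Longrightarrow> T \<subseteq> pverts G \<Longrightarrow> m T = int (card (orientations adjacent r T))"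
begin

lemma m_not_connected:
  assumes "T \<subseteq> pverts G" "T \<noteq> {}" "\<not> Digraph_Component.connected (with_proj G \<restriction> T)"
  shows "m T = 0"
proof -
  obtain r where r: "r \<in> T" using assms(2) by auto
  have "rooted_words adjacent r T = {}"
    using connected_rooted_word assms(3) by (auto simp: rooted_words_def)
  then show ?thesis using m[OF r assms(1)] by (simp add: orientations_def)
qed

text \<open>The refinements of \<open>\<pi>\<close> are the bond partitions of the graph obtained by deleting the edges
  between different blocks of \<open>\<pi>\<close>; if \<open>\<pi>\<close> is not the bottom, that graph still has an edge.\<close>

lemma sum_refinements:
  assumes \<pi>: "\<pi> \<in> bond_partitions G" "\<pi> \<noteq> bond_bottom G"
  shows "(\<Sum>\<rho> | (\<rho>, \<pi>) \<in> bond_order G. \<Prod>B\<in>\<rho>. - m B) = 0"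
proof -
  let ?V = "pverts G"
  let ?adj = "\<lambda>x y. adjacent x y \<and> (\<exists>C\<in>\<pi>. x \<in> C \<and> y \<in> C)"
  \<comment> \<open>The counterpart of \<open>m\<close> for the graph without the edges between
    blocks: a set inside no block is disconnected there.\<close>
  let ?f = "\<lambda>T. if \<exists>C\<in>\<pi>. T \<subseteq> C then m T else 0"
  have part: "partition_on ?V \<pi>" and conn: "\<And>C. C \<in> \<pi> \<Longrightarrow> Digraph_Component.connected (with_proj G \<restriction> C)"
    using \<pi>(1) by (auto simp: bond_partitions_def)
  have disj: "C = D" if "C \<in> \<pi>" "D \<in> \<pi>" "x \<in> C" "x \<in> D" for C D x
    using part that by (auto simp: partition_on_def disjoint_def)
  interpret a: simple_adjacency ?adj
    using adjacent_sym by unfold_locales (auto dest: no_loops)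
  have block: "\<exists>C\<in>\<pi>. set w \<subseteq> C" if "rooted_word ?adj w" "set w \<subseteq> ?V" for w
    using that
  proof (induction w)
    case (Cons x w)
    show ?case
    proof (cases "w = []")
      case True
      then show ?thesis using Cons.prems(2) part by (auto simp: partition_on_def)
    next
      case False
      then obtain C where C: "C \<in> \<pi>" "set w \<subseteq> C" using Cons by auto
      obtain y D where "y \<in> set w" "D \<in> \<pi>" "x \<in> D" "y \<in> D" using Cons.prems(1) False by auto
      then have "x \<in> C" using C disj[of D C y] by auto
      then show ?thesis using C by auto
    qed
  qed simp
  have f: "?f T = int (card (orientations ?adj r T))" if rT: "r \<in> T" "T \<subseteq> ?V" for r T
  proof (cases "\<exists>C\<in>\<pi>. T \<subseteq> C")
    case True
    then have "orientations ?adj r T = orientations adjacent r T"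
      by (intro orientations_cong) auto
    then show ?thesis using True m[OF rT] by simp
  next
    case False
    have "w \<notin> rooted_words ?adj r T" for w
      using block[of w] False rT(2) by (auto simp: rooted_words_def)
    then have "rooted_words ?adj r T = {}"
      by blast
    then show ?thesis using False by (simp add: orientations_def)
  qed
  have fin: "finite \<rho>" if "partition_on ?V \<rho>" for \<rho>
    using that pair_finite_verts by (rule finite_elements[rotated])
  have "(\<Sum>\<rho> | (\<rho>, \<pi>) \<in> bond_order G. \<Prod>B\<in>\<rho>. - m B) = (\<Sum>\<rho> | partition_on ?V \<rho>. \<Prod>B\<in>\<rho>. - ?f B)"
  proof (rule sum.mono_neutral_cong_left)
    show "finite {\<rho>. partition_on ?V \<rho>}"
      using pair_finite_verts by (rule finitely_many_partition_on)
    show "{\<rho>. (\<rho>, \<pi>) \<in> bond_order G} \<subseteq> {\<rho>. partition_on ?V \<rho>}"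
      by (auto simp: bond_order_def bond_partitions_def)
  next
    \<comment> \<open>A partition that is no bond partition below \<pi> has a block that is
      disconnected or meets several blocks of \<pi>, so one factor is 0.\<close>
    show "\<forall>\<rho>\<in>{\<rho>. partition_on ?V \<rho>} - {\<rho>. (\<rho>, \<pi>) \<in> bond_order G}. (\<Prod>B\<in>\<rho>. - ?f B) = 0"
    proof
      fix \<rho> assume \<rho>: "\<rho> \<in> {\<rho>. partition_on ?V \<rho>} - {\<rho>. (\<rho>, \<pi>) \<in> bond_order G}"
      then have p: "partition_on ?V \<rho>" by simp
      obtain B where B: "B \<in> \<rho>"
        "\<not> Digraph_Component.connected (with_proj G \<restriction> B) \<or> \<not> (\<exists>C\<in>\<pi>. B \<subseteq> C)"
        using \<rho> \<pi>(1) part by (auto simp: bond_order_def bond_partitions_def refines_def)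
      have "B \<subseteq> ?V" "B \<noteq> {}" using p B(1) by (auto simp: partition_on_def)
      then have "- ?f B = 0" using B(2) m_not_connected[of B] by auto
      then have "\<exists>B\<in>\<rho>. - ?f B = 0" using B(1) by blast
      then show "(\<Prod>B\<in>\<rho>. - ?f B) = 0"
        using fin[OF p] by (intro prod_zero)
    qed
  next
    fix \<rho> assume "\<rho> \<in> {\<rho>. (\<rho>, \<pi>) \<in> bond_order G}"
    then show "(\<Prod>B\<in>\<rho>. - m B) = (\<Prod>B\<in>\<rho>. - ?f B)"
      by (intro prod.cong HOL.refl) (auto simp: bond_order_def refines_def)
  qed
  also have "\<dots> = signed_independent ?adj ?V"
    by (rule a.sum_partition_on_orientations[OF pair_finite_verts f])
  also have "\<dots> = 0"
  proof -
    have "\<exists>C\<in>\<pi>. \<exists>u\<in>C. \<exists>v\<in>C. u \<noteq> v"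
    proof (rule ccontr)
      assume single: "\<not> ?thesis"
      have eq: "C = {v}" if "C \<in> \<pi>" "v \<in> C" for C v
        using single that by blast
      have "\<pi> = bond_bottom G"
        unfolding bond_bottom_def
      proof (intro set_eqI iffI)
        fix C assume C: "C \<in> \<pi>"
        then have "C \<noteq> {}" using part by (auto simp: partition_on_def)
        then obtain v where "v \<in> C" by auto
        moreover from this have "v \<in> ?V" using C part by (auto simp: partition_on_def)
        ultimately show "C \<in> (\<lambda>v. {v}) ` ?V"
          using eq[OF C] by blast
      next
        fix C assume "C \<in> (\<lambda>v. {v}) ` ?V"
        then obtain v where v: "v \<in> ?V" "C = {v}" by auto
        then obtain D where "D \<in> \<pi>" "v \<in> D" using part by (auto simp: partition_on_def)
        then show "C \<in> \<pi>" using eq[of D v] v by simp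
      qed
      then show False using \<pi>(2) by simp
    qed
    then obtain C u v where C: "C \<in> \<pi>" "u \<in> C" "v \<in> C" "u \<noteq> v" by auto
    obtain x y where "x \<in> C" "y \<in> C" "adjacent x y"
      using connected_obtain_edge[OF conn[OF C(1)] C(2-4)] .
    then have "\<not> independent_set ?adj ?V"
      using C(1) by (auto simp: independent_set_def dest: in_arcsD1 in_arcsD2)
    then show ?thesis by (simp add: signed_independent_def)
  qed
  finally show ?thesis .
qed

text \<open>Up to the common factor given by the parity of the number of vertices, the sign is that
  of the product of the \<open>- m B\<close>, so \<open>sum_refinements\<close> is the recursion
  that defines the Moebius function.\<close>

lemma mobius_bond_order:
  assumes "\<pi> \<in> bond_partitions G"
  shows "mobius (bond_order G) (bond_bottom G) \<pi> =
    (-1) ^ (card (pverts G) - card \<pi>) * (\<Prod>B\<in>\<pi>. m B)"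
  using assms
proof (induction "bond_order G" "bond_bottom G" \<pi> rule: mobius.induct)
  case (1 \<pi>)
  let ?r = "bond_order G" and ?b = "bond_bottom G" and ?V = "pverts G"
  let ?F = "\<lambda>\<rho>. (-1) ^ (card ?V - card \<rho>) * (\<Prod>B\<in>\<rho>. m B)"
  have le: "(?b, \<pi>) \<in> ?r" using 1(2) by (rule bond_bottom_le)
  have F: "?F \<rho> = (-1) ^ card ?V * (\<Prod>B\<in>\<rho>. - m B)" if "\<rho> \<in> bond_partitions G" for \<rho>
  proof -
    have p: "partition_on ?V \<rho>" using that by (simp add: bond_partitions_def)
    have fin: "finite B" if "B \<in> \<rho>" for B
      using p that pair_finite_verts by (auto simp: partition_on_def intro: finite_subset)
    \<comment> \<open>Blocks are non-empty, so the truncated subtraction in the exponent is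
      exact.\<close>
    have "card \<rho> = (\<Sum>B\<in>\<rho>. 1)"
      by simp
    also have "\<dots> \<le> (\<Sum>B\<in>\<rho>. card B)"
      using p fin by (intro sum_mono) (auto simp: partition_on_def card_gt_0_iff Suc_le_eq)
    also have "\<dots> = card ?V"
      using product_partition[OF p fin] by simp
    finally have "card \<rho> \<le> card ?V" .
    then have "(-1 :: int) ^ card ?V * (-1) ^ card \<rho> = (-1) ^ (card ?V - card \<rho>)"
      by (simp add: power_add[symmetric] minus_one_power_iff)
    then show ?thesis by (simp add: prod_uminus mult.assoc[symmetric])
  qed
  show ?case
  proof (cases "\<pi> = ?b")
    case True
    have "m {v} = 1" if "v \<in> ?V" for v
      using m[of v "{v}"] that by (simp add: orientations_def rooted_words_singleton)
    then have "(\<Prod>B\<in>?b. m B) = 1"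
      by (auto simp: bond_bottom_def intro!: prod.neutral)
    moreover have "card ?b = card ?V"
      unfolding bond_bottom_def by (rule card_image) simp
    ultimately show ?thesis
      using True le finite_bond_order partial_order_on_bond_order by (simp add: mobius.simps[of ?r])
  next
    case False
    let ?Z = "{\<rho>. (?b, \<rho>) \<in> ?r \<and> (\<rho>, \<pi>) \<in> ?r \<and> \<rho> \<noteq> \<pi>}"
    have "mobius ?r ?b \<pi> = - (\<Sum>\<rho>\<in>?Z. mobius ?r ?b \<rho>)"
      using False le finite_bond_order partial_order_on_bond_order
      by (simp add: mobius.simps[of ?r ?b \<pi>])
    also have "(\<Sum>\<rho>\<in>?Z. mobius ?r ?b \<rho>) = (\<Sum>\<rho>\<in>?Z. ?F \<rho>)"
      using False le finite_bond_order partial_order_on_bond_order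
      by (intro sum.cong HOL.refl 1(1)) (auto simp: bond_order_def)
    also have "\<dots> = (\<Sum>\<rho> | (\<rho>, \<pi>) \<in> ?r. ?F \<rho>) - ?F \<pi>"
    proof -
      \<comment> \<open>Every bond partition lies above the bottom, so the interval up to \<pi>
        consists of all refinements of \<pi>.\<close>
      have "{\<rho>. (\<rho>, \<pi>) \<in> ?r} = insert \<pi> ?Z"
        using 1(2) bond_bottom_le by (auto simp: bond_order_def bond_partitions_def intro: refines_refl)
      moreover have "finite ?Z"
        using finite_subset[OF _ finite_imageI[OF finite_bond_order, of fst], of ?Z] by force
      ultimately show ?thesis by simp
    qed
    also have "(\<Sum>\<rho> | (\<rho>, \<pi>) \<in> ?r. ?F \<rho>) = (-1) ^ card ?V * (\<Sum>\<rho> | (\<rho>, \<pi>) \<in> ?r. \<Prod>B\<in>\<rho>. - m B)"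
      unfolding sum_distrib_left by (intro sum.cong HOL.refl F) (auto simp: bond_order_def)
    also have "\<dots> = 0"
      using sum_refinements[OF 1(2) False] by simp
    finally show ?thesis by simp
  qed
qed

end

end

theorem proposition1p4:
  fixes G :: "'v pair_pre_digraph"
    and hscale :: "complex \<Rightarrow> 'h::ab_group_add \<Rightarrow> 'h"
    and \<alpha> :: "'v \<Rightarrow> 'h \<Rightarrow> complex" and \<alpha>v :: "'v \<Rightarrow> 'h"
    and scale :: "complex \<Rightarrow> 'g::ab_group_add \<Rightarrow> 'g" and bracket :: "'g \<Rightarrow> 'g \<Rightarrow> 'g"
    and \<gamma> :: "('v, 'h) km_gen \<Rightarrow> 'g"
    and \<pi> :: "'v set set"
  assumes "pair_graph G"
    and "kac_moody_algebra hscale (pverts G) (graph_cartan_matrix G) \<alpha> \<alpha>v scale bracket \<gamma>"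
    and "\<pi> \<in> bond_partitions G"
  shows "mobius (bond_order G) (bond_bottom G) \<pi> =
    (-1) ^ (card (pverts G) - card \<pi>) * int (partition_mult scale bracket \<gamma> \<alpha> \<pi>)"
proof -
  interpret pair_graph G by fact
  interpret simply_laced_kac_moody hscale "pverts G" "graph_cartan_matrix G" \<alpha> \<alpha>v scale bracket \<gamma>
    adjacent
    using assms(2) simple_adjacency_adjacent
    by (simp add: simply_laced_kac_moody_def simply_laced_kac_moody_axioms_def
        graph_cartan_matrix_def adjacency_def)
  have "mobius (bond_order G) (bond_bottom G) \<pi> = (-1) ^ (card (pverts G) - card \<pi>) *
      (\<Prod>B\<in>\<pi>. int (root_mult scale bracket \<gamma> (root_sum \<alpha> B)))"
    \<comment> \<open>\<open>root_mult_root_sum\<close> is available for every \<open>r\<close> in a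
      block, as the assumption on \<open>m\<close> requires.\<close>
    using assms(3) by (intro mobius_bond_order) (simp_all add: root_mult_root_sum)
  then show ?thesis
    by (simp add: partition_mult_def)
qed

end
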